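(* Let $\{X(t), t\in\mathbb{R}\}$ be the queue-length process of the $M_t/G/\infty$ queue with arrival intensity $\{\lambda(t),t\in\mathbb{R}\}$ and service time distribution $G$. Let $\bar G(t):=1-G(t)$, assume that $$H(t):=\int_0^\infty \bar G(u)\lambda(t-u)\,du<\infty\quad\text{for all } t\in\mathbb{R},$$ and for $0\le a<b\le\infty$ let $$H_{a,b}(t):=\int_a^b \bar G(u)\lambda(t-u)\,du.$$ Let $m\ge 1$, let $t_1<\cdots<t_m$ be fixed real points, and let $t_0=-\infty$ by convention (so that $t_{k+1}-t_0=\infty$). Then for any $\theta=(\theta_1,\ldots,\theta_m)\in\mathbb{R}^m$, $$\ln \mathbb{E}_G\Big[\exp\Big\{\sum_{i=1}^m\theta_iX(t_i)\Big\}\Big]=\sum_{k=1}^m(e^{\theta_k}-1)H(t_k)+\sum_{k=1}^{m-1}(e^{\theta_{k+1}}-1)\sum_{j=0}^{k-1}\Big(e^{\sum_{i=j+1}^k\theta_i}-1\Big)H_{t_{k+1}-t_{j+1},\,t_{k+1}-t_j}(t_{k+1}).$$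
   Context: The $M_t/G/\infty$ queue: $\{\tau_j,j\in\mathbb{Z}\}$ are the points (arrival epochs) of a non-homogeneous Poisson process on $\mathbb{R}$ with intensity function $\lambda(t)\ge 0$, $t\in\mathbb{R}$. The service times $\{\sigma_j,j\in\mathbb{Z}\}$ are positive independent random variables with common distribution function $G$, independent of $\{\tau_j\}$. The queue-length process (number of busy servers) is $X(t)=\sum_{j\in\mathbb{Z}}\mathbf{1}(\tau_j\le t,\ \sigma_j>t-\tau_j)$, $t\in\mathbb{R}$. $\mathbb{E}_G$ denotes expectation with respect to the probability measure generated by $\{X(t),t\in\mathbb{R}\}$ when the service time distribution is $G$. *)

theory Defs
  imports "HOL-Probability.Probability"
begin

text \<open>
  Arrival epochs are indexed by the integers and take values in \<^typ>\<open>ereal\<close>: the values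
  \<^term>\<open>\<infinity>\<close> and \<^term>\<open>-\<infinity>\<close> mark unused indices, so that intensities whose integral over a
  half-line is finite (only finitely many arrivals there) are covered. Only finite epochs are
  points of the process. Intensity integrals are taken in \<^typ>\<open>ennreal\<close>.
\<close>

definition point_count :: "(int \<Rightarrow> 'a \<Rightarrow> ereal) \<Rightarrow> real set \<Rightarrow> 'a \<Rightarrow> ennreal" where
  "point_count \<tau> A \<omega> = emeasure (count_space UNIV) {j. \<tau> j \<omega> \<in> ereal ` A}"

definition intensity_measure :: "(real \<Rightarrow> real) \<Rightarrow> real measure" where
  "intensity_measure lam = density lborel (\<lambda>x. ennreal (lam x))"

text \<open>
  The Poisson probabilities are written out because \<^const>\<open>poisson_pmf\<close> is only meaningful for a
  positive rate, whereas sets of mean measure zero must be allowed here.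
\<close>

locale poisson_points = prob_space M for M :: "'a measure" +
  fixes lam :: "real \<Rightarrow> real" and \<tau> :: "int \<Rightarrow> 'a \<Rightarrow> ereal"
  assumes intensity_measurable: "lam \<in> borel_measurable borel"
    and intensity_nonneg: "\<And>x. 0 \<le> lam x"
    and epoch_measurable: "\<And>j. \<tau> j \<in> borel_measurable M"
    and count_poisson:
      "\<And>A n. A \<in> sets borel \<Longrightarrow> emeasure (intensity_measure lam) A < \<infinity> \<Longrightarrow>
         prob {\<omega> \<in> space M. point_count \<tau> A \<omega> = of_nat n} =
           measure (intensity_measure lam) A ^ n / fact n * exp (- measure (intensity_measure lam) A)"
    and count_infinite:
      "\<And>A. A \<in> sets borel \<Longrightarrow> emeasure (intensity_measure lam) A = \<infinity> \<Longrightarrow>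
         AE \<omega> in M. point_count \<tau> A \<omega> = \<infinity>"
    and count_independent:
      "\<And>(A :: nat \<Rightarrow> real set) n. (\<And>i. i < n \<Longrightarrow> A i \<in> sets borel) \<Longrightarrow>
         disjoint_family_on A {..<n} \<Longrightarrow>
         indep_vars (\<lambda>_. borel) (\<lambda>i. point_count \<tau> (A i)) {..<n}"

locale Mt_G_infinity_queue = poisson_points M lam \<tau>
  for M :: "'a measure" and lam :: "real \<Rightarrow> real" and \<tau> :: "int \<Rightarrow> 'a \<Rightarrow> ereal" +
  fixes \<sigma> :: "int \<Rightarrow> 'a \<Rightarrow> real" and G :: "real \<Rightarrow> real"
  assumes service_positive: "\<And>j. AE \<omega> in M. 0 < \<sigma> j \<omega>"
    and service_independent: "indep_vars (\<lambda>_. borel) \<sigma> UNIV"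
    and service_cdf: "\<And>j. cdf (distr M borel (\<sigma> j)) = G"
    and service_arrival_independent:
      "indep_set
         (sets (vimage_algebra (space M) (\<lambda>\<omega> j. \<tau> j \<omega>) (Pi\<^sub>M UNIV (\<lambda>_. borel))))
         (sets (vimage_algebra (space M) (\<lambda>\<omega> j. \<sigma> j \<omega>) (Pi\<^sub>M UNIV (\<lambda>_. borel))))"

text \<open>
  An index with \<^term>\<open>\<tau> j \<omega> = \<infinity>\<close> or \<^term>\<open>\<tau> j \<omega> = -\<infinity>\<close> contributes nothing. The infinite
  sum takes the default value 0 where it diverges; if \<open>H t\<close> is finite, that happens only on a
  null set, because \<open>H t\<close> is the mean queue length.
\<close>

definition queue_length ::
    "(int \<Rightarrow> 'a \<Rightarrow> ereal) \<Rightarrow> (int \<Rightarrow> 'a \<Rightarrow> real) \<Rightarrow> real \<Rightarrow> 'a \<Rightarrow> real" where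
  "queue_length \<tau> \<sigma> t \<omega> =
     (\<Sum>\<^sub>\<infinity>j\<in>UNIV. of_bool (\<tau> j \<omega> \<le> ereal t \<and> ereal (\<sigma> j \<omega>) > ereal t - \<tau> j \<omega>))"

definition H_between ::
    "(real \<Rightarrow> real) \<Rightarrow> (real \<Rightarrow> real) \<Rightarrow> ereal \<Rightarrow> ereal \<Rightarrow> real \<Rightarrow> real" where
  "H_between G lam a b t = (LBINT u=a..b. (1 - G u) * lam (t - u))"

definition H_total :: "(real \<Rightarrow> real) \<Rightarrow> (real \<Rightarrow> real) \<Rightarrow> real \<Rightarrow> real" where
  "H_total G lam t = (LBINT u=0..\<infinity>. (1 - G u) * lam (t - u))"

text \<open>Since the integrand is nonnegative and measurable, integrability says that \<open>H t\<close> is finite.\<close>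

definition H_finite :: "(real \<Rightarrow> real) \<Rightarrow> (real \<Rightarrow> real) \<Rightarrow> real \<Rightarrow> bool" where
  "H_finite G lam t \<longleftrightarrow> interval_lebesgue_integrable lborel 0 \<infinity> (\<lambda>u. (1 - G u) * lam (t - u))"

definition ext_time :: "(nat \<Rightarrow> real) \<Rightarrow> nat \<Rightarrow> ereal" where
  "ext_time t j = (if j = 0 then -\<infinity> else ereal (t j))"

end

theory Submission
  imports Defs "HOL-Library.Nat_Bijection"
begin

text \<open>
  A customer who arrives at \<open>x\<close> with service time \<open>s\<close> contributes
  \<open>f x s = \<Sum>\<^sub>i \<theta>\<^sub>i 1(x \<le> t\<^sub>i < x + s)\<close> to \<open>\<Sum>\<^sub>i \<theta>\<^sub>i X(t\<^sub>i)\<close>. Arrivals form a Poisson process and the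
  service times are independent marks, so the exponential formula for marked Poisson processes gives
  \<open>ln E exp (\<Sum>\<^sub>i \<theta>\<^sub>i X(t\<^sub>i)) = \<integral> \<lambda>(x) E (exp (f x \<sigma>) - 1) dx\<close>, which is
  \<open>expectation_exp_mark_sum\<close>. The right-hand side of the theorem is this integral written out.

  The exponential formula is first proved without marks (\<open>expectation_exp_sum_epochs\<close>). For simple
  functions it is independence of the counts of disjoint sets together with the Poisson moment
  generating function (\<open>exp_sum_epochs_simple\<close>). Since the \<open>\<theta>\<^sub>i\<close> may have either sign, the passage to
  general functions cannot rest on monotone convergence alone. The case of nonnegative functions is
  therefore used to build integrable majorants (\<open>exp_partial_sums_bounded\<close>,
  \<open>exp_sum_epochs_nonneg\<close>), and dominated convergence does the rest.

  Marks enter through conditioning on the epochs: in a product over finitely many indices each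
  service time is integrated out separately (\<open>nn_integral_prod_marks\<close>). This replaces \<open>f x s\<close> by the
  function \<open>ln E exp (f x \<sigma>)\<close> of the epoch alone, to which the unmarked formula applies. Finiteness
  of \<open>H(t\<^sub>i)\<close> is the integrability that this needs, because \<open>H(t\<^sub>i)\<close> is the integral of
  \<open>\<lambda>(x) P(x \<le> t\<^sub>i < x + \<sigma>)\<close>.

  Finally, \<open>exp (f x s) - 1\<close> telescopes over the observation times (\<open>exp_sum_busy\<close>). A customer present
  at \<open>t\<^sub>k\<^sub>+\<^sub>1\<close> was present at exactly those earlier \<open>t\<^sub>i\<close> that are not before the arrival, so the sum
  splits according to the interval \<open>(t\<^sub>j, t\<^sub>j\<^sub>+\<^sub>1]\<close> containing the arrival. The substitution
  \<open>u = t\<^sub>k\<^sub>+\<^sub>1 - x\<close> then produces the integrals over \<open>[t\<^sub>k\<^sub>+\<^sub>1 - t\<^sub>j\<^sub>+\<^sub>1, t\<^sub>k\<^sub>+\<^sub>1 - t\<^sub>j)\<close>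
  (\<open>has_integral_H_between\<close>).
\<close>

section \<open>Sums over the points of a Poisson process\<close>

text \<open>
  Epochs live in \<^typ>\<open>ereal\<close>, and an infinite epoch is an unused index. Extending \<open>\<phi>\<close> by 0 to
  the infinite values lets sums over the points be written as sums over all indices.
\<close>

definition at_epoch :: "(real \<Rightarrow> real) \<Rightarrow> ereal \<Rightarrow> real" where
  "at_epoch \<phi> x = (if \<bar>x\<bar> = \<infinity> then 0 else \<phi> (real_of_ereal x))"

lemma at_epoch_measurable [measurable]:
  assumes [measurable]: "\<phi> \<in> borel_measurable borel"
  shows "at_epoch \<phi> \<in> borel_measurable borel"
  unfolding at_epoch_def by measurable

lemma space_intensity [simp]: "space (intensity_measure lam) = UNIV"
  by (simp add: intensity_measure_def)

lemma sets_intensity [simp, measurable_cong]: "sets (intensity_measure lam) = sets borel"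
  by (simp add: intensity_measure_def)

text \<open>
  For a function with finitely many values, grouping the points by the value they receive turns the
  sum over points into a finite combination of point counts. Finiteness of the counts makes all but
  finitely many summands vanish, so no rearrangement of an infinite series is involved.
\<close>

lemma sums_at_epoch_finite_range:
  assumes V: "finite V" "0 \<notin> V" and FV: "\<And>x. F x \<noteq> 0 \<Longrightarrow> F x \<in> V"
    and fin: "\<And>v. v \<in> V \<Longrightarrow> point_count \<tau> (F -` {v}) \<omega> \<noteq> \<infinity>"
  shows "(\<lambda>n. at_epoch F (\<tau> (int_decode n) \<omega>)) sums
    (\<Sum>v\<in>V. v * enn2real (point_count \<tau> (F -` {v}) \<omega>))"
proof -
  let ?J = "\<lambda>v. {j. \<tau> j \<omega> \<in> ereal ` (F -` {v})}"
  let ?f = "\<lambda>j. at_epoch F (\<tau> j \<omega>)"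
  have finJ: "finite (?J v)" if "v \<in> V" for v
    using fin[OF that] by (simp add: point_count_def emeasure_count_space split: if_splits)
  have card: "enn2real (point_count \<tau> (F -` {v}) \<omega>) = real (card (?J v))" if "v \<in> V" for v
    using finJ[OF that]
    by (simp add: point_count_def emeasure_count_space ennreal_of_nat_eq_real_of_nat)
  have val: "?f j = v" if "j \<in> ?J v" for j v
    using that by (auto simp: at_epoch_def)
  have supp: "?f j = 0" if "j \<notin> (\<Union>v\<in>V. ?J v)" for j
  proof (rule ccontr)
    assume nz: "?f j \<noteq> 0"
    then obtain x where x: "\<tau> j \<omega> = ereal x" by (cases "\<tau> j \<omega>") (auto simp: at_epoch_def)
    with nz have "F x \<in> V" by (intro FV) (auto simp: at_epoch_def)
    with that x show False by auto
  qed
  have finU: "finite (\<Union>v\<in>V. ?J v)" using V finJ by auto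
  have bij: "bij_betw int_decode (int_decode -` (\<Union>v\<in>V. ?J v)) (\<Union>v\<in>V. ?J v)"
    by (rule bij_betw_subset[OF bij_int_decode]) (auto simp: surj_int_decode image_vimage_eq)
  have "(\<lambda>n. ?f (int_decode n)) sums (\<Sum>n\<in>int_decode -` (\<Union>v\<in>V. ?J v). ?f (int_decode n))"
    using bij_betw_finite[OF bij] finU supp by (intro sums_finite) auto
  also have "(\<Sum>n\<in>int_decode -` (\<Union>v\<in>V. ?J v). ?f (int_decode n)) = (\<Sum>j\<in>(\<Union>v\<in>V. ?J v). ?f j)"
    by (rule sum.reindex_bij_betw[OF bij])
  also have "\<dots> = (\<Sum>v\<in>V. \<Sum>j\<in>?J v. ?f j)"
    using V finJ by (intro sum.UNION_disjoint) auto
  also have "\<dots> = (\<Sum>v\<in>V. \<Sum>j\<in>?J v. v)"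
    by (intro sum.cong refl val)
  finally show ?thesis
    by (simp add: card mult.commute)
qed

context poisson_points
begin

abbreviation "epoch n \<omega> \<equiv> \<tau> (int_decode n) \<omega>"
abbreviation "mean_measure \<equiv> intensity_measure lam"

declare epoch_measurable [measurable]

lemma point_count_measurable [measurable]:
  assumes [measurable]: "A \<in> sets borel"
  shows "point_count \<tau> A \<in> borel_measurable M"
proof -
  \<comment> \<open>The count is a series of measurable indicators, one for each index.\<close>
  have eq: "point_count \<tau> A \<omega> = (\<Sum>n. indicator A (real_of_ereal (epoch n \<omega>)) *
      (if \<bar>epoch n \<omega>\<bar> = \<infinity> then 0 else 1))" for \<omega>
  proof -
    have "point_count \<tau> A \<omega> = (\<integral>\<^sup>+j. indicator {j. \<tau> j \<omega> \<in> ereal ` A} j \<partial>count_space UNIV)"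
      unfolding point_count_def by simp
    also have "\<dots> = (\<integral>\<^sup>+n. indicator {j. \<tau> j \<omega> \<in> ereal ` A} (int_decode n) \<partial>count_space UNIV)"
      by (rule nn_integral_bij_count_space[symmetric]) (rule bij_int_decode)
    also have "\<dots> = (\<Sum>n. indicator {j. \<tau> j \<omega> \<in> ereal ` A} (int_decode n))"
      by (rule nn_integral_count_space_nat)
    also have "\<dots> = (\<Sum>n. indicator A (real_of_ereal (epoch n \<omega>)) *
      (if \<bar>epoch n \<omega>\<bar> = \<infinity> then 0 else 1))"
      by (intro suminf_cong) (auto split: split_indicator, metis ereal_real imageI)
    finally show ?thesis .
  qed
  show ?thesis unfolding eq[abs_def] by measurable
qed

text \<open>
  The Poisson law is only given at each natural number. Since the Poisson weights sum to 1, no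
  probability is left for the value \<^term>\<open>\<infinity>\<close>.
\<close>

lemma point_count_eq_nat_AE:
  assumes A: "A \<in> sets borel" "emeasure mean_measure A < \<infinity>"
  shows "AE \<omega> in M. \<exists>n. point_count \<tau> A \<omega> = of_nat n"
proof -
  have [measurable]: "point_count \<tau> A \<in> borel_measurable M" using A(1) by measurable
  let ?m = "measure mean_measure A"
  let ?E = "\<lambda>n. {\<omega> \<in> space M. point_count \<tau> A \<omega> = of_nat n}"
  have "prob (\<Union>n. ?E n) = 1"
  proof -
    have "(\<lambda>n. prob (?E n)) sums prob (\<Union>n. ?E n)"
      by (rule finite_measure_UNION) (auto simp: disjoint_family_on_def)
    moreover have "(\<lambda>n. prob (?E n)) sums 1"
    proof -
      have "(\<lambda>n. exp (- ?m) * (?m ^ n /\<^sub>R fact n)) sums (exp (- ?m) * exp ?m)"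
        by (intro sums_mult exp_converges)
      then show ?thesis
        by (simp add: count_poisson[OF A] exp_minus divide_simps mult.commute)
    qed
    ultimately show ?thesis by (rule sums_unique2)
  qed
  then show ?thesis by (subst (asm) prob_eq_1) auto
qed

lemma nn_integral_exp_point_count:
  assumes A: "A \<in> sets borel" "emeasure mean_measure A < \<infinity>"
  shows "(\<integral>\<^sup>+\<omega>. ennreal (exp (c * enn2real (point_count \<tau> A \<omega>))) \<partial>M) =
    ennreal (exp ((exp c - 1) * measure mean_measure A))"
proof -
  have [measurable]: "point_count \<tau> A \<in> borel_measurable M" using A(1) by measurable
  let ?m = "measure mean_measure A"
  let ?E = "\<lambda>n. {\<omega> \<in> space M. point_count \<tau> A \<omega> = of_nat n}"
  have "(\<integral>\<^sup>+\<omega>. ennreal (exp (c * enn2real (point_count \<tau> A \<omega>))) \<partial>M) =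
    (\<integral>\<^sup>+\<omega>. (\<Sum>n. ennreal (exp (c * real n)) * indicator (?E n) \<omega>) \<partial>M)"
  proof (rule nn_integral_cong_AE)
    show "AE \<omega> in M. ennreal (exp (c * enn2real (point_count \<tau> A \<omega>))) =
        (\<Sum>n. ennreal (exp (c * real n)) * indicator (?E n) \<omega>)"
      using point_count_eq_nat_AE[OF A] AE_space
    proof eventually_elim
      case (elim \<omega>)
      then obtain k where k: "point_count \<tau> A \<omega> = of_nat k" by auto
      have "(\<Sum>n. ennreal (exp (c * real n)) * indicator (?E n) \<omega>) =
          (\<Sum>n\<in>{k}. ennreal (exp (c * real n)) * indicator (?E n) \<omega>)"
        using k by (intro suminf_finite) (auto split: split_indicator)
      then show ?case using k elim by (simp add: ennreal_of_nat_eq_real_of_nat)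
    qed
  qed
  also have "\<dots> = (\<Sum>n. \<integral>\<^sup>+\<omega>. ennreal (exp (c * real n)) * indicator (?E n) \<omega> \<partial>M)"
    by (rule nn_integral_suminf) measurable
  also have "\<dots> = (\<Sum>n. ennreal (exp (c * real n) * prob (?E n)))"
    by (intro suminf_cong) (simp add: nn_integral_cmult emeasure_eq_measure ennreal_mult)
  also have "\<dots> = (\<Sum>n. ennreal (exp (- ?m) * ((exp c * ?m) ^ n /\<^sub>R fact n)))"
    by (intro suminf_cong arg_cong[where f=ennreal])
       (simp add: count_poisson[OF A] divide_simps power_mult_distrib exp_of_nat2_mult)
  also have "\<dots> = ennreal (exp (- ?m) * exp (exp c * ?m))"
    by (intro suminf_ennreal_eq sums_mult exp_converges) (simp add: measure_nonneg)
  also have "exp (- ?m) * exp (exp c * ?m) = exp ((exp c - 1) * ?m)"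
    by (simp add: exp_add[symmetric] algebra_simps)
  finally show ?thesis .
qed

text \<open>
  For a simple function the exponential of the sum over points is a product of exponentials of point
  counts of disjoint sets. Independence of these counts factorises the expectation, and each factor is
  a Poisson moment generating function.
\<close>

lemma exp_sum_epochs_simple:
  assumes F: "simple_function borel F" and fin: "emeasure mean_measure {x. F x \<noteq> 0} < \<infinity>"
  shows "AE \<omega> in M. summable (\<lambda>n. at_epoch F (epoch n \<omega>))"
    and "(\<integral>\<^sup>+\<omega>. ennreal (exp (\<Sum>n. at_epoch F (epoch n \<omega>))) \<partial>M) =
      ennreal (exp (\<integral>x. (exp (F x) - 1) \<partial>mean_measure))"
proof -
  have Fm [measurable]: "F \<in> borel_measurable borel"
    using F by (rule borel_measurable_simple_function)
  define V where "V = F ` UNIV - {0}"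
  have V: "finite V" "0 \<notin> V" "\<And>x. F x \<noteq> 0 \<Longrightarrow> F x \<in> V"
    using F by (auto simp: V_def simple_function_def)
  have sets: "F -` {v} \<in> sets borel" for v
    using measurable_sets[OF Fm, of "{v}"] by simp
  have finv: "emeasure mean_measure (F -` {v}) < \<infinity>" if "v \<in> V" for v
  proof -
    have "emeasure mean_measure (F -` {v}) \<le> emeasure mean_measure {x. F x \<noteq> 0}"
      using that V(2) by (intro emeasure_mono) auto
    then show ?thesis using fin by (rule le_less_trans)
  qed
  let ?N = "\<lambda>v. point_count \<tau> (F -` {v})"
  have "AE \<omega> in M. \<forall>v\<in>V. ?N v \<omega> \<noteq> \<infinity>"
    using V(1)
  proof (rule AE_finite_allI)
    fix v assume "v \<in> V"
    from point_count_eq_nat_AE[OF sets finv[OF this]]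
    show "AE \<omega> in M. ?N v \<omega> \<noteq> \<infinity>"
      by eventually_elim auto
  qed
  then have sums: "AE \<omega> in M. (\<lambda>n. at_epoch F (epoch n \<omega>)) sums (\<Sum>v\<in>V. v * enn2real (?N v \<omega>))"
    by eventually_elim (rule sums_at_epoch_finite_range[OF V], auto)
  then show "AE \<omega> in M. summable (\<lambda>n. at_epoch F (epoch n \<omega>))"
    by eventually_elim (rule sums_summable)
  \<comment> \<open>Independence of counts refers to families indexed by an initial segment of \<open>nat\<close>.\<close>
  obtain v where v: "bij_betw v {..<card V} V"
    using ex_bij_betw_nat_finite[OF V(1)] by (auto simp: lessThan_atLeast0)
  have "(\<integral>\<^sup>+\<omega>. ennreal (exp (\<Sum>n. at_epoch F (epoch n \<omega>))) \<partial>M) =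
      (\<integral>\<^sup>+\<omega>. (\<Prod>i<card V. ennreal (exp (v i * enn2real (?N (v i) \<omega>)))) \<partial>M)"
  proof (rule nn_integral_cong_AE)
    show "AE \<omega> in M. ennreal (exp (\<Sum>n. at_epoch F (epoch n \<omega>))) =
        (\<Prod>i<card V. ennreal (exp (v i * enn2real (?N (v i) \<omega>))))"
      using sums
    proof eventually_elim
      case (elim \<omega>)
      show ?case unfolding sums_unique[OF elim, symmetric]
        using V(1) by (simp add: sum.reindex_bij_betw[OF v, symmetric] exp_sum prod_ennreal)
    qed
  qed
  also have "\<dots> = (\<Prod>i<card V. \<integral>\<^sup>+\<omega>. ennreal (exp (v i * enn2real (?N (v i) \<omega>))) \<partial>M)"
  proof (rule indep_vars_nn_integral)
    have dis: "disjoint_family_on (\<lambda>i. F -` {v i}) {..<card V}"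
      using v by (auto simp: disjoint_family_on_def bij_betw_def inj_on_def)
    have "indep_vars (\<lambda>_. borel) (\<lambda>i. ?N (v i)) {..<card V}"
      by (rule count_independent) (auto intro: sets dis)
    then show "indep_vars (\<lambda>_. borel) (\<lambda>i \<omega>. ennreal (exp (v i * enn2real (?N (v i) \<omega>)))) {..<card V}"
      by (rule indep_vars_compose2[where Y="\<lambda>i y. ennreal (exp (v i * enn2real y))"]) measurable
  qed auto
  also have "\<dots> = (\<Prod>i<card V. ennreal (exp ((exp (v i) - 1) * measure mean_measure (F -` {v i}))))"
    using v by (intro prod.cong refl nn_integral_exp_point_count sets finv) (auto simp: bij_betw_def)
  also have "\<dots> = ennreal (exp (\<Sum>u\<in>V. (exp u - 1) * measure mean_measure (F -` {u})))"
    by (simp add: sum.reindex_bij_betw[OF v, symmetric] exp_sum prod_ennreal)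
  also have "(\<Sum>u\<in>V. (exp u - 1) * measure mean_measure (F -` {u})) =
      (\<Sum>u\<in>V. \<integral>x. (exp u - 1) * indicator (F -` {u}) x \<partial>mean_measure)"
    by simp
  also have "\<dots> = (\<integral>x. (\<Sum>u\<in>V. (exp u - 1) * indicator (F -` {u}) x) \<partial>mean_measure)"
    using finv sets by (intro Bochner_Integration.integral_sum[symmetric] integrable_mult_right integrable_real_indicator) auto
  also have "\<dots> = (\<integral>x. (exp (F x) - 1) \<partial>mean_measure)"
  proof (rule Bochner_Integration.integral_cong[OF refl])
    fix x
    have "(\<Sum>u\<in>V. (exp u - 1) * indicator (F -` {u}) x) = (\<Sum>u\<in>V. if u = F x then exp u - 1 else 0)"
      by (intro sum.cong) (auto split: split_indicator)
    also have "\<dots> = exp (F x) - 1"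
      using V by auto
    finally show "(\<Sum>u\<in>V. (exp u - 1) * indicator (F -` {u}) x) = exp (F x) - 1" .
  qed
  finally show "(\<integral>\<^sup>+\<omega>. ennreal (exp (\<Sum>n. at_epoch F (epoch n \<omega>))) \<partial>M) =
      ennreal (exp (\<integral>x. (exp (F x) - 1) \<partial>mean_measure))" .
qed

end

section \<open>The exponential formula for a Poisson process\<close>

text \<open>
  Summability is obtained from exponential moments: a uniform bound on those of the partial sums passes
  to their supremum by monotone convergence, so the partial sums are almost surely bounded. The
  exponential of the full sum then serves as an integrable majorant in all later limits.
\<close>

lemma exp_partial_sums_bounded:
  fixes a :: "nat \<Rightarrow> 'a \<Rightarrow> real"
  assumes [measurable]: "\<And>n. a n \<in> borel_measurable M" and nonneg: "\<And>n \<omega>. 0 \<le> a n \<omega>"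
    and bound: "\<And>n. (\<integral>\<^sup>+\<omega>. ennreal (exp (\<Sum>j<n. a j \<omega>)) \<partial>M) \<le> ennreal C"
  shows "AE \<omega> in M. summable (\<lambda>n. a n \<omega>)"
    and "integrable M (\<lambda>\<omega>. exp (\<Sum>n. a n \<omega>))"
proof -
  let ?S = "\<lambda>\<omega>. SUP n. ennreal (exp (\<Sum>j<n. a j \<omega>))"
  have "(\<integral>\<^sup>+\<omega>. ?S \<omega> \<partial>M) = (SUP n. \<integral>\<^sup>+\<omega>. ennreal (exp (\<Sum>j<n. a j \<omega>)) \<partial>M)"
    by (rule nn_integral_monotone_convergence_SUP)
       (auto simp: incseq_def le_fun_def nonneg intro!: ennreal_leI sum_mono2)
  also have "\<dots> \<le> ennreal C" by (rule SUP_least) (rule bound)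
  finally have S: "(\<integral>\<^sup>+\<omega>. ?S \<omega> \<partial>M) < \<infinity>" by (rule le_less_trans) simp
  then have "AE \<omega> in M. ?S \<omega> \<noteq> \<infinity>" by (intro nn_integral_PInf_AE) auto
  then have main: "AE \<omega> in M. summable (\<lambda>n. a n \<omega>) \<and> ennreal (exp (\<Sum>n. a n \<omega>)) \<le> ?S \<omega>"
  proof eventually_elim
    case (elim \<omega>)
    then obtain K where K: "?S \<omega> = ennreal K" "0 \<le> K" by (cases "?S \<omega>") auto
    have le: "exp (\<Sum>j<n. a j \<omega>) \<le> K" for n
    proof -
      have "ennreal (exp (\<Sum>j<n. a j \<omega>)) \<le> ?S \<omega>" by (rule SUP_upper) simp
      then show ?thesis using K by simp
    qed
    have sm: "summable (\<lambda>n. a n \<omega>)"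
    proof (rule summableI_nonneg_bounded[where x=K])
      show "(\<Sum>j<n. a j \<omega>) \<le> K" for n
        using le[of n] exp_ge_add_one_self[of "\<Sum>j<n. a j \<omega>"] by linarith
    qed (rule nonneg)
    have "exp (\<Sum>n. a n \<omega>) \<le> K"
      using summable_LIMSEQ[OF sm]
      by (intro LIMSEQ_le_const2[OF tendsto_exp]) (auto intro: le)
    then show ?case using sm K by (simp add: ennreal_leI)
  qed
  then show "AE \<omega> in M. summable (\<lambda>n. a n \<omega>)" by auto
  have "(\<integral>\<^sup>+\<omega>. ennreal (exp (\<Sum>n. a n \<omega>)) \<partial>M) \<le> (\<integral>\<^sup>+\<omega>. ?S \<omega> \<partial>M)"
    using main by (intro nn_integral_mono_AE) auto
  also note S
  finally show "integrable M (\<lambda>\<omega>. exp (\<Sum>n. a n \<omega>))"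
    by (intro integrableI_nonneg) auto
qed

lemma abs_exp_minus_one_le:
  fixes x :: real
  assumes "\<bar>x\<bar> \<le> B"
  shows "\<bar>exp x - 1\<bar> \<le> exp B * \<bar>x\<bar>"
proof (cases "0 \<le> x")
  case True
  have "exp x * (1 - x) \<le> exp x * exp (- x)"
    using exp_ge_add_one_self[of "- x"] by (intro mult_left_mono) auto
  then have "exp x - 1 \<le> exp x * x" by (simp add: exp_minus algebra_simps)
  also have "\<dots> \<le> exp B * x" using True assms by (intro mult_right_mono) auto
  finally show ?thesis using True by simp
next
  case False
  have "1 - exp x \<le> - x" using exp_ge_add_one_self[of x] by linarith
  also have "\<dots> = 1 * \<bar>x\<bar>" using False by simp
  also have "\<dots> \<le> exp B * \<bar>x\<bar>" using False assms by (intro mult_right_mono) auto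
  finally show ?thesis using False by simp
qed

text \<open>
  An integrable simple function is supported on a set of finite measure, so the Poisson law of counts
  applies to its level sets even when the intensity has infinite total mass.
\<close>

lemma simple_approximation_integrable:
  fixes \<phi> :: "'a \<Rightarrow> real"
  assumes \<phi>: "integrable N \<phi>"
  obtains F where "\<And>k. simple_function N (F k)"
    and "\<And>k. emeasure N {x \<in> space N. F k x \<noteq> 0} \<noteq> \<infinity>"
    and "\<And>x. x \<in> space N \<Longrightarrow> (\<lambda>k. F k x) \<longlonglongrightarrow> \<phi> x"
    and "\<And>k x. x \<in> space N \<Longrightarrow> \<bar>F k x\<bar> \<le> 2 * \<bar>\<phi> x\<bar>"
proof -
  from borel_measurable_implies_sequence_metric[OF borel_measurable_integrable[OF \<phi>], of 0]
  obtain F where F: "\<And>k. simple_function N (F k)"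
      "\<And>x. x \<in> space N \<Longrightarrow> (\<lambda>k. F k x) \<longlonglongrightarrow> \<phi> x"
      "\<And>k x. x \<in> space N \<Longrightarrow> \<bar>F k x\<bar> \<le> 2 * \<bar>\<phi> x\<bar>"
    by (simp add: dist_real_def) blast
  have "emeasure N {x \<in> space N. F k x \<noteq> 0} \<noteq> \<infinity>" for k
  proof -
    have "integrable N (F k)"
      using \<phi> F by (intro Bochner_Integration.integrable_bound[where g="F k" and f="\<lambda>x. 2 * \<phi> x"])
         (auto simp: abs_mult borel_measurable_simple_function)
    then have fin: "(\<integral>\<^sup>+x. ennreal (norm (F k x)) \<partial>N) < \<infinity>"
      by (simp add: integrable_iff_bounded)
    from simple_bochner_integrableI_bounded[OF F(1) fin] show ?thesis
      by (rule simple_bochner_integrable.cases) auto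
  qed
  with F that show ?thesis by blast
qed

lemma at_epoch_abs: "\<bar>at_epoch \<phi> x\<bar> = at_epoch (\<lambda>x. \<bar>\<phi> x\<bar>) x"
  by (simp add: at_epoch_def)

lemma at_epoch_nonneg: "(\<And>x. 0 \<le> \<phi> x) \<Longrightarrow> 0 \<le> at_epoch \<phi> x"
  by (simp add: at_epoch_def)

context poisson_points
begin

lemma exp_sum_epochs_simple_integral:
  assumes F: "simple_function mean_measure F" "emeasure mean_measure {x. F x \<noteq> 0} \<noteq> \<infinity>"
  shows "AE \<omega> in M. summable (\<lambda>n. at_epoch F (epoch n \<omega>))"
    and "integrable M (\<lambda>\<omega>. exp (\<Sum>n. at_epoch F (epoch n \<omega>)))"
    and "expectation (\<lambda>\<omega>. exp (\<Sum>n. at_epoch F (epoch n \<omega>))) = exp (\<integral>x. (exp (F x) - 1) \<partial>mean_measure)"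
proof -
  have sF: "simple_function borel F"
    using F(1) by (simp add: simple_function_def)
  then have [measurable]: "F \<in> borel_measurable borel" by (rule borel_measurable_simple_function)
  have fin: "emeasure mean_measure {x. F x \<noteq> 0} < \<infinity>" using F(2) by (simp add: less_top)
  note * = exp_sum_epochs_simple[OF sF fin]
  show "AE \<omega> in M. summable (\<lambda>n. at_epoch F (epoch n \<omega>))" by (rule *(1))
  have [measurable]: "(\<lambda>\<omega>. exp (\<Sum>n. at_epoch F (epoch n \<omega>))) \<in> borel_measurable M" by measurable
  show "integrable M (\<lambda>\<omega>. exp (\<Sum>n. at_epoch F (epoch n \<omega>)))"
    by (intro integrableI_nonneg) (auto simp: *(2))
  show "expectation (\<lambda>\<omega>. exp (\<Sum>n. at_epoch F (epoch n \<omega>))) = exp (\<integral>x. (exp (F x) - 1) \<partial>mean_measure)"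
    by (subst integral_eq_nn_integral) (auto simp: *(2))
qed

text \<open>
  Fatou's lemma carries a bound that is uniform along simple approximations over to the partial sums
  for \<open>\<phi>\<close>. The finite bound is what later gives integrable majorants for signed functions.
\<close>

lemma exp_sum_epochs_nonneg:
  assumes \<phi>: "integrable mean_measure \<phi>" and nonneg: "\<And>x. 0 \<le> \<phi> x" and bounded: "\<And>x. \<phi> x \<le> B"
  shows "AE \<omega> in M. summable (\<lambda>n. at_epoch \<phi> (epoch n \<omega>))"
    and "integrable M (\<lambda>\<omega>. exp (\<Sum>n. at_epoch \<phi> (epoch n \<omega>)))"
    and "\<exists>C. \<forall>n. (\<integral>\<^sup>+\<omega>. ennreal (exp (\<Sum>j<n. at_epoch \<phi> (epoch j \<omega>))) \<partial>M) \<le> ennreal C"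
proof -
  have \<phi>m [measurable]: "\<phi> \<in> borel_measurable borel"
    using borel_measurable_integrable[OF \<phi>] by (simp add: measurable_cong_sets[OF sets_intensity])
  obtain F where F: "\<And>k. simple_function mean_measure (F k)"
    and supp: "\<And>k. emeasure mean_measure {x. F k x \<noteq> 0} \<noteq> \<infinity>"
    and lim: "\<And>x. (\<lambda>k. F k x) \<longlonglongrightarrow> \<phi> x"
    and bound: "\<And>k x. \<bar>F k x\<bar> \<le> 2 * \<bar>\<phi> x\<bar>"
    by (rule simple_approximation_integrable[OF \<phi>]) auto
  \<comment> \<open>The approximations may be negative although \<open>\<phi>\<close> is not; their absolute values still converge to \<open>\<phi>\<close>.\<close>
  define P where "P k x = \<bar>F k x\<bar>" for k x
  have P: "simple_function mean_measure (P k)" "emeasure mean_measure {x. P k x \<noteq> 0} \<noteq> \<infinity>" for k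
    using simple_function_compose1[OF F[of k], of abs] supp[of k] by (auto simp: P_def[abs_def])
  have Pm [measurable]: "P k \<in> borel_measurable borel" for k
    using borel_measurable_simple_function[OF P(1)[of k]] by (simp add: measurable_cong_sets[OF sets_intensity])
  have P_lim: "(\<lambda>k. P k x) \<longlonglongrightarrow> \<phi> x" for x
    using tendsto_rabs[OF lim[of x]] nonneg[of x] by (simp add: P_def)
  have P_nonneg: "0 \<le> P k x" for k x by (simp add: P_def)
  have P_le: "P k x \<le> 2 * \<phi> x" for k x using bound[of k x] nonneg[of x] by (simp add: P_def)
  \<comment> \<open>By \<open>P k x \<le> 2 * \<phi> x \<le> 2 * B\<close> the exponent \<open>exp (P k x) - 1\<close> is at most \<open>exp (2 * B) * (2 * \<phi> x)\<close>.\<close>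
  define C where "C = exp (\<integral>x. exp (2 * B) * (2 * \<phi> x) \<partial>mean_measure)"
  have PC: "(\<integral>\<^sup>+\<omega>. ennreal (exp (\<Sum>j<n. at_epoch (P k) (epoch j \<omega>))) \<partial>M) \<le> ennreal C" for n k
  proof -
    have "(\<integral>\<^sup>+\<omega>. ennreal (exp (\<Sum>j<n. at_epoch (P k) (epoch j \<omega>))) \<partial>M) \<le>
        (\<integral>\<^sup>+\<omega>. ennreal (exp (\<Sum>j. at_epoch (P k) (epoch j \<omega>))) \<partial>M)"
    proof (rule nn_integral_mono_AE)
      show "AE \<omega> in M. ennreal (exp (\<Sum>j<n. at_epoch (P k) (epoch j \<omega>))) \<le>
          ennreal (exp (\<Sum>j. at_epoch (P k) (epoch j \<omega>)))"
        using exp_sum_epochs_simple_integral(1)[OF P, of k]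
        by eventually_elim (auto intro!: ennreal_leI sum_le_suminf at_epoch_nonneg P_nonneg)
    qed
    also have "\<dots> = ennreal (exp (\<integral>x. (exp (P k x) - 1) \<partial>mean_measure))"
      by (simp add: nn_integral_eq_integral exp_sum_epochs_simple_integral[OF P])
    also have "\<dots> \<le> ennreal C"
      unfolding C_def
    proof (intro ennreal_leI, subst exp_le_cancel_iff, rule integral_mono_AE')
      show "integrable mean_measure (\<lambda>x. exp (2 * B) * (2 * \<phi> x))" using \<phi> by simp
      have "exp (P k x) - 1 \<le> exp (2 * B) * (2 * \<phi> x)" for x
      proof -
        have "\<bar>P k x\<bar> \<le> 2 * B"
          using P_le[of k x] P_nonneg[of k x] bounded[of x] by linarith
        from abs_exp_minus_one_le[OF this]
        have "exp (P k x) - 1 \<le> exp (2 * B) * P k x" using P_nonneg[of k x] by simp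
        also have "\<dots> \<le> exp (2 * B) * (2 * \<phi> x)" using P_le by (intro mult_left_mono) auto
        finally show ?thesis .
      qed
      then show "AE x in mean_measure. exp (P k x) - 1 \<le> exp (2 * B) * (2 * \<phi> x)" by auto
    qed (auto simp: nonneg)
    finally show ?thesis .
  qed
  have C: "(\<integral>\<^sup>+\<omega>. ennreal (exp (\<Sum>j<n. at_epoch \<phi> (epoch j \<omega>))) \<partial>M) \<le> ennreal C" for n
  proof -
    have "(\<integral>\<^sup>+\<omega>. ennreal (exp (\<Sum>j<n. at_epoch \<phi> (epoch j \<omega>))) \<partial>M) =
        (\<integral>\<^sup>+\<omega>. liminf (\<lambda>k. ennreal (exp (\<Sum>j<n. at_epoch (P k) (epoch j \<omega>)))) \<partial>M)"
    proof (rule nn_integral_cong)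
      fix \<omega>
      have "(\<lambda>k. at_epoch (P k) x) \<longlonglongrightarrow> at_epoch \<phi> x" for x
        by (simp add: at_epoch_def P_lim)
      then have "(\<lambda>k. ennreal (exp (\<Sum>j<n. at_epoch (P k) (epoch j \<omega>)))) \<longlonglongrightarrow>
          ennreal (exp (\<Sum>j<n. at_epoch \<phi> (epoch j \<omega>)))"
        by (intro tendsto_ennrealI tendsto_exp tendsto_sum)
      then show "ennreal (exp (\<Sum>j<n. at_epoch \<phi> (epoch j \<omega>))) =
          liminf (\<lambda>k. ennreal (exp (\<Sum>j<n. at_epoch (P k) (epoch j \<omega>))))"
        by (intro lim_imp_Liminf[symmetric]) simp
    qed
    also have "\<dots> \<le> liminf (\<lambda>k. \<integral>\<^sup>+\<omega>. ennreal (exp (\<Sum>j<n. at_epoch (P k) (epoch j \<omega>))) \<partial>M)"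
      by (rule nn_integral_liminf) measurable
    also have "\<dots> \<le> liminf (\<lambda>k. ennreal C)"
      by (intro Liminf_mono always_eventually allI PC)
    finally show ?thesis by (simp add: Liminf_const)
  qed
  then show "\<exists>C. \<forall>n. (\<integral>\<^sup>+\<omega>. ennreal (exp (\<Sum>j<n. at_epoch \<phi> (epoch j \<omega>))) \<partial>M) \<le> ennreal C"
    by blast
  show "AE \<omega> in M. summable (\<lambda>n. at_epoch \<phi> (epoch n \<omega>))"
    "integrable M (\<lambda>\<omega>. exp (\<Sum>n. at_epoch \<phi> (epoch n \<omega>)))"
    using exp_partial_sums_bounded[OF _ _ C] nonneg by (auto simp: at_epoch_def)
qed

text \<open>
  The exponential formula of Campbell for signed \<open>\<phi>\<close>. The simple approximations satisfy
  \<open>\<bar>F k x\<bar> \<le> 2 * \<bar>\<phi> x\<bar>\<close>, so that sums over points converge by Tannery's theorem, and the exponential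
  of the sum of \<open>2 * \<bar>\<phi>\<bar>\<close> over the points dominates on the probability space.
\<close>

theorem expectation_exp_sum_epochs:
  assumes \<phi>: "integrable mean_measure \<phi>" and bounded: "\<And>x. \<bar>\<phi> x\<bar> \<le> B"
  shows "expectation (\<lambda>\<omega>. exp (\<Sum>n. at_epoch \<phi> (epoch n \<omega>))) =
    exp (\<integral>x. (exp (\<phi> x) - 1) \<partial>mean_measure)"
proof -
  have \<phi>m [measurable]: "\<phi> \<in> borel_measurable borel"
    using borel_measurable_integrable[OF \<phi>] by (simp add: measurable_cong_sets[OF sets_intensity])
  obtain F where F: "\<And>k. simple_function mean_measure (F k)"
      "\<And>k. emeasure mean_measure {x. F k x \<noteq> 0} \<noteq> \<infinity>"
    and lim: "\<And>x. (\<lambda>k. F k x) \<longlonglongrightarrow> \<phi> x"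
    and bound: "\<And>k x. \<bar>F k x\<bar> \<le> 2 * \<bar>\<phi> x\<bar>"
    by (rule simple_approximation_integrable[OF \<phi>]) auto
  have Fm [measurable]: "F k \<in> borel_measurable borel" for k
    using borel_measurable_simple_function[OF F(1)[of k]] by (simp add: measurable_cong_sets[OF sets_intensity])
  let ?w = "\<lambda>x. 2 * \<bar>\<phi> x\<bar>"
  have w: "integrable mean_measure ?w" "\<And>x. 0 \<le> ?w x" "\<And>x. ?w x \<le> 2 * B"
    using \<phi> bounded by auto
  have "(\<lambda>k. expectation (\<lambda>\<omega>. exp (\<Sum>n. at_epoch (F k) (epoch n \<omega>)))) \<longlonglongrightarrow>
      expectation (\<lambda>\<omega>. exp (\<Sum>n. at_epoch \<phi> (epoch n \<omega>)))"
  proof (rule integral_dominated_convergence)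
    show "integrable M (\<lambda>\<omega>. exp (\<Sum>n. at_epoch ?w (epoch n \<omega>)))"
      by (rule exp_sum_epochs_nonneg(2)[OF w])
    have le: "\<bar>at_epoch (F k) x\<bar> \<le> at_epoch ?w x" for k x
      using bound by (simp add: at_epoch_def)
    show "AE \<omega> in M. norm (exp (\<Sum>n. at_epoch (F k) (epoch n \<omega>))) \<le> exp (\<Sum>n. at_epoch ?w (epoch n \<omega>))" for k
      using exp_sum_epochs_nonneg(1)[OF w] exp_sum_epochs_simple_integral(1)[OF F, of k]
    proof eventually_elim
      case (elim \<omega>)
      have "(\<Sum>n. at_epoch (F k) (epoch n \<omega>)) \<le> (\<Sum>n. at_epoch ?w (epoch n \<omega>))"
        using elim by (intro suminf_le abs_le_D1[OF le]) auto
      then show ?case by simp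
    qed
    show "AE \<omega> in M. (\<lambda>k. exp (\<Sum>n. at_epoch (F k) (epoch n \<omega>))) \<longlonglongrightarrow>
        exp (\<Sum>n. at_epoch \<phi> (epoch n \<omega>))"
      using exp_sum_epochs_nonneg(1)[OF w]
    proof eventually_elim
      case (elim \<omega>)
      show ?case
      proof (intro tendsto_exp)
        show "(\<lambda>k. \<Sum>n. at_epoch (F k) (epoch n \<omega>)) \<longlonglongrightarrow> (\<Sum>n. at_epoch \<phi> (epoch n \<omega>))"
        proof (rule tannerys_theorem[THEN conjunct2, THEN conjunct2])
          show "(\<lambda>k. at_epoch (F k) (epoch n \<omega>)) \<longlonglongrightarrow> at_epoch \<phi> (epoch n \<omega>)" for n
            by (simp add: at_epoch_def lim)
          show "eventually (\<lambda>(n, k). norm (at_epoch (F k) (epoch n \<omega>)) \<le> at_epoch ?w (epoch n \<omega>))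
              (at_top \<times>\<^sub>F sequentially)"
            using le by (intro always_eventually) auto
        qed (use elim in auto)
      qed
    qed
  qed measurable
  moreover have "(\<lambda>k. exp (\<integral>x. (exp (F k x) - 1) \<partial>mean_measure)) \<longlonglongrightarrow>
      exp (\<integral>x. (exp (\<phi> x) - 1) \<partial>mean_measure)"
  proof (intro tendsto_exp integral_dominated_convergence)
    show "integrable mean_measure (\<lambda>x. exp (2 * B) * ?w x)" using w(1) by simp
    show "AE x in mean_measure. (\<lambda>k. exp (F k x) - 1) \<longlonglongrightarrow> exp (\<phi> x) - 1"
      by (intro AE_I2 tendsto_intros lim)
    have "\<bar>exp (F k x) - 1\<bar> \<le> exp (2 * B) * ?w x" for k x
    proof -
      have "\<bar>F k x\<bar> \<le> 2 * B" using bound[of k x] bounded[of x] by linarith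
      from abs_exp_minus_one_le[OF this] have "\<bar>exp (F k x) - 1\<bar> \<le> exp (2 * B) * \<bar>F k x\<bar>" .
      also have "\<dots> \<le> exp (2 * B) * ?w x" using bound by (intro mult_left_mono) auto
      finally show ?thesis .
    qed
    then show "AE x in mean_measure. norm (exp (F k x) - 1) \<le> exp (2 * B) * ?w x" for k
      by auto
  qed measurable
  ultimately show ?thesis
    unfolding exp_sum_epochs_simple_integral(3)[OF F] by (rule LIMSEQ_unique)
qed

end

section \<open>Independent marking by service times\<close>

lemma measurable_curried:
  assumes "case_prod f \<in> A \<Otimes>\<^sub>M B \<rightarrow>\<^sub>M C" "u \<in> N \<rightarrow>\<^sub>M A" "v \<in> N \<rightarrow>\<^sub>M B"
  shows "(\<lambda>\<omega>. f (u \<omega>) (v \<omega>)) \<in> N \<rightarrow>\<^sub>M C"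
  using measurable_compose[OF measurable_Pair[OF assms(2,3)] assms(1)] by simp

text \<open>
  Dominated convergence for exponentials of partial sums, with the absolute series as majorant. It is
  used twice below: for the marked points and for the points after averaging over the marks.
\<close>

lemma integral_exp_partial_sums_tendsto:
  fixes a :: "nat \<Rightarrow> 'a \<Rightarrow> real"
  assumes a [measurable]: "\<And>n. a n \<in> borel_measurable M"
    and sm: "AE \<omega> in M. summable (\<lambda>n. \<bar>a n \<omega>\<bar>)"
    and w: "integrable M (\<lambda>\<omega>. exp (\<Sum>n. \<bar>a n \<omega>\<bar>))"
  shows "integrable M (\<lambda>\<omega>. exp (\<Sum>n. a n \<omega>))"
    and "(\<lambda>n. \<integral>\<omega>. exp (\<Sum>j<n. a j \<omega>) \<partial>M) \<longlonglongrightarrow> (\<integral>\<omega>. exp (\<Sum>n. a n \<omega>) \<partial>M)"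
proof -
  have lim: "AE \<omega> in M. (\<lambda>n. exp (\<Sum>j<n. a j \<omega>)) \<longlonglongrightarrow> exp (\<Sum>n. a n \<omega>)"
    using sm by eventually_elim (rule tendsto_exp[OF summable_LIMSEQ[OF summable_rabs_cancel]])
  have le: "AE \<omega> in M. norm (exp (\<Sum>j<n. a j \<omega>)) \<le> exp (\<Sum>n. \<bar>a n \<omega>\<bar>)" for n
    using sm
  proof eventually_elim
    case (elim \<omega>)
    have "(\<Sum>j<n. a j \<omega>) \<le> (\<Sum>j<n. \<bar>a j \<omega>\<bar>)" by (intro sum_mono) auto
    also have "\<dots> \<le> (\<Sum>n. \<bar>a n \<omega>\<bar>)" using elim by (intro sum_le_suminf) auto
    finally show ?case by simp
  qed
  show "integrable M (\<lambda>\<omega>. exp (\<Sum>n. a n \<omega>))"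
    by (rule integrable_dominated_convergence[OF _ _ w lim le]) measurable
  show "(\<lambda>n. \<integral>\<omega>. exp (\<Sum>j<n. a j \<omega>) \<partial>M) \<longlonglongrightarrow> (\<integral>\<omega>. exp (\<Sum>n. a n \<omega>) \<partial>M)"
    by (rule integral_dominated_convergence[OF _ _ w lim le]) measurable
qed

context Mt_G_infinity_queue
begin

abbreviation "service_law \<equiv> distr M borel (\<sigma> 0)"

lemma service_measurable [measurable]: "\<sigma> j \<in> borel_measurable M"
  using service_independent by (auto simp: indep_vars_def)

lemma service_law_real_distribution: "real_distribution service_law"
  by (intro real_distribution_distr) simp

lemma distr_service: "distr M borel (\<sigma> j) = service_law"
proof (rule cdf_unique)
  show "real_distribution (distr M borel (\<sigma> j))" by (intro real_distribution_distr) simp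
  show "real_distribution service_law" by (rule service_law_real_distribution)
  show "cdf (distr M borel (\<sigma> j)) = cdf service_law" by (simp only: service_cdf)
qed

sublocale service: real_distribution service_law
  by (rule service_law_real_distribution)

text \<open>
  Given the epochs, the service times are independent with common law \<open>service_law\<close>. Hence, over
  finitely many indices, the marks may be integrated out one factor at a time. The epochs and the
  service times are independent as whole sequences, so the joint law is a product and Fubini's theorem
  applies.
\<close>

lemma nn_integral_prod_marks:
  fixes g :: "ereal \<Rightarrow> real \<Rightarrow> ennreal"
  assumes g: "case_prod g \<in> borel_measurable (borel \<Otimes>\<^sub>M borel)" and J: "finite J"
  shows "(\<integral>\<^sup>+\<omega>. (\<Prod>j\<in>J. g (\<tau> j \<omega>) (\<sigma> j \<omega>)) \<partial>M) =
    (\<integral>\<^sup>+\<omega>. (\<Prod>j\<in>J. \<integral>\<^sup>+s. g (\<tau> j \<omega>) s \<partial>service_law) \<partial>M)"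
proof -
  let ?PT = "Pi\<^sub>M (UNIV :: int set) (\<lambda>_. borel :: ereal measure)"
  let ?PS = "Pi\<^sub>M (UNIV :: int set) (\<lambda>_. borel :: real measure)"
  let ?T = "\<lambda>\<omega> j. \<tau> j \<omega>" and ?S = "\<lambda>\<omega> j. \<sigma> j \<omega>"
  have T [measurable]: "?T \<in> M \<rightarrow>\<^sub>M ?PT" by (rule measurable_PiM_single') auto
  have S [measurable]: "?S \<in> M \<rightarrow>\<^sub>M ?PS" by (rule measurable_PiM_single') auto
  interpret S: prob_space "distr M ?PS ?S" by (rule prob_space_distr) (rule S)
  interpret T: prob_space "distr M ?PT ?T" by (rule prob_space_distr) (rule T)
  have pair: "distr M ?PT ?T \<Otimes>\<^sub>M distr M ?PS ?S = distr M (?PT \<Otimes>\<^sub>M ?PS) (\<lambda>\<omega>. (?T \<omega>, ?S \<omega>))"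
  proof (rule pair_measure_eqI)
    show "sigma_finite_measure (distr M ?PT ?T)" "sigma_finite_measure (distr M ?PS ?S)"
      by unfold_locales
    fix A B assume "A \<in> sets (distr M ?PT ?T)" "B \<in> sets (distr M ?PS ?S)"
    then have AB: "A \<in> sets ?PT" "B \<in> sets ?PS" by simp_all
    have "prob ((?T -` A \<inter> space M) \<inter> (?S -` B \<inter> space M)) =
        prob (?T -` A \<inter> space M) * prob (?S -` B \<inter> space M)"
      using AB by (intro indep_setD[OF service_arrival_independent] in_vimage_algebra)
    moreover have "(\<lambda>\<omega>. (?T \<omega>, ?S \<omega>)) -` (A \<times> B) \<inter> space M =
        (?T -` A \<inter> space M) \<inter> (?S -` B \<inter> space M)"
      by auto
    ultimately show "emeasure (distr M ?PT ?T) A * emeasure (distr M ?PS ?S) B =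
        emeasure (distr M (?PT \<Otimes>\<^sub>M ?PS) (\<lambda>\<omega>. (?T \<omega>, ?S \<omega>))) (A \<times> B)"
      using AB by (simp add: emeasure_distr emeasure_eq_measure ennreal_mult)
  qed simp
  have gm: "(\<lambda>\<omega>. g (u \<omega>) (v \<omega>)) \<in> borel_measurable N"
    if "u \<in> borel_measurable N" "v \<in> borel_measurable N" for u v and N :: "'b measure"
    by (rule measurable_curried[OF g that])
  have gx: "g y \<in> borel_measurable borel" for y
    by (rule measurable_curried[OF g]) simp_all
  have m1: "(\<lambda>z. \<Prod>j\<in>J. g (fst z j) (snd z j)) \<in> borel_measurable (?PT \<Otimes>\<^sub>M ?PS)"
    by (intro borel_measurable_prod_ennreal gm) measurable
  have m2: "(\<lambda>y. \<Prod>j\<in>J. g (x j) (y j)) \<in> borel_measurable ?PS" for x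
    by (intro borel_measurable_prod_ennreal gm) measurable
  have inner: "(\<integral>\<^sup>+y. (\<Prod>j\<in>J. g (x j) (y j)) \<partial>distr M ?PS ?S) =
      (\<Prod>j\<in>J. \<integral>\<^sup>+s. g (x j) s \<partial>service_law)" for x
  proof -
    have "(\<integral>\<^sup>+y. (\<Prod>j\<in>J. g (x j) (y j)) \<partial>distr M ?PS ?S) = (\<integral>\<^sup>+\<omega>. (\<Prod>j\<in>J. g (x j) (\<sigma> j \<omega>)) \<partial>M)"
      by (rule nn_integral_distr[OF S]) (simp add: m2)
    also have "\<dots> = (\<Prod>j\<in>J. \<integral>\<^sup>+\<omega>. g (x j) (\<sigma> j \<omega>) \<partial>M)"
    proof (rule indep_vars_nn_integral[OF J])
      have "indep_vars (\<lambda>_. borel) \<sigma> J"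
        by (rule indep_vars_subset[OF service_independent]) simp
      then show "indep_vars (\<lambda>_. borel) (\<lambda>j \<omega>. g (x j) (\<sigma> j \<omega>)) J"
        by (rule indep_vars_compose2) (rule gx)
    qed simp
    also have "\<dots> = (\<Prod>j\<in>J. \<integral>\<^sup>+s. g (x j) s \<partial>service_law)"
    proof (rule prod.cong[OF refl])
      fix j
      show "(\<integral>\<^sup>+\<omega>. g (x j) (\<sigma> j \<omega>) \<partial>M) = (\<integral>\<^sup>+s. g (x j) s \<partial>service_law)"
        unfolding distr_service[of j, symmetric] by (simp add: nn_integral_distr gx)
    qed
    finally show ?thesis .
  qed
  have "(\<integral>\<^sup>+\<omega>. (\<Prod>j\<in>J. g (\<tau> j \<omega>) (\<sigma> j \<omega>)) \<partial>M) =
      (\<integral>\<^sup>+z. (\<Prod>j\<in>J. g (fst z j) (snd z j)) \<partial>distr M (?PT \<Otimes>\<^sub>M ?PS) (\<lambda>\<omega>. (?T \<omega>, ?S \<omega>)))"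
    by (subst nn_integral_distr) (use m1 in auto)
  also have "\<dots> = (\<integral>\<^sup>+x. \<integral>\<^sup>+y. (\<Prod>j\<in>J. g (x j) (y j)) \<partial>distr M ?PS ?S \<partial>distr M ?PT ?T)"
    unfolding pair[symmetric] by (subst S.nn_integral_fst[symmetric]) (use m1 in \<open>auto cong: measurable_cong_sets\<close>)
  also have "\<dots> = (\<integral>\<^sup>+x. (\<Prod>j\<in>J. \<integral>\<^sup>+s. g (x j) s \<partial>service_law) \<partial>distr M ?PT ?T)"
    by (simp only: inner)
  also have "\<dots> = (\<integral>\<^sup>+\<omega>. (\<Prod>j\<in>J. \<integral>\<^sup>+s. g (\<tau> j \<omega>) s \<partial>service_law) \<partial>M)"
  proof (rule nn_integral_distr[OF T])
    have "(\<lambda>y. \<integral>\<^sup>+s. g y s \<partial>service_law) \<in> borel_measurable borel"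
      by (intro service.borel_measurable_nn_integral) (use g in \<open>simp cong: measurable_cong_sets\<close>)
    then show "(\<lambda>x. \<Prod>j\<in>J. \<integral>\<^sup>+s. g (x j) s \<partial>service_law) \<in> borel_measurable (distr M ?PT ?T)"
      by measurable
  qed
  finally show ?thesis .
qed

definition mark_sum_term :: "(real \<Rightarrow> real \<Rightarrow> real) \<Rightarrow> nat \<Rightarrow> 'a \<Rightarrow> real" where
  "mark_sum_term f n \<omega> = at_epoch (\<lambda>x. f x (\<sigma> (int_decode n) \<omega>)) (epoch n \<omega>)"

text \<open>
  Averaging the factor \<open>exp (f x s)\<close> over the mark \<open>s\<close> again gives an exponential, namely of
  this function of the epoch alone. Thus a sum over marked points is replaced by a sum over points.
\<close>

definition mark_log_mean :: "(real \<Rightarrow> real \<Rightarrow> real) \<Rightarrow> real \<Rightarrow> real" where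
  "mark_log_mean f x = ln (\<integral>s. exp (f x s) \<partial>service_law)"

lemma mark_sum_term_measurable:
  assumes f: "case_prod f \<in> borel_measurable (borel \<Otimes>\<^sub>M borel)"
  shows "mark_sum_term f n \<in> borel_measurable M"
proof -
  have [measurable]: "(\<lambda>\<omega>. f (real_of_ereal (epoch n \<omega>)) (\<sigma> (int_decode n) \<omega>)) \<in> borel_measurable M"
    by (rule measurable_curried[OF f]) measurable
  show ?thesis unfolding mark_sum_term_def[abs_def] at_epoch_def by measurable
qed

context
  fixes f :: "real \<Rightarrow> real \<Rightarrow> real" and B :: real
  assumes f: "case_prod f \<in> borel_measurable (borel \<Otimes>\<^sub>M borel)" and bounded: "\<And>x s. \<bar>f x s\<bar> \<le> B"
begin

lemma mark_section_measurable: "f x \<in> borel_measurable borel"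
  by (rule measurable_curried[OF f]) simp_all

lemma mark_section_integrable: "integrable service_law (f x)" "integrable service_law (\<lambda>s. exp (f x s))"
proof -
  note [measurable] = mark_section_measurable
  show "integrable service_law (f x)"
    by (rule service.integrable_const_bound[where B=B]) (auto simp: bounded)
  show "integrable service_law (\<lambda>s. exp (f x s))"
    by (rule service.integrable_const_bound[where B="exp B"]) (auto simp: abs_le_D1[OF bounded])
qed

lemma mark_mean_bounds:
  shows "exp (- B) \<le> (\<integral>s. exp (f x s) \<partial>service_law)" "(\<integral>s. exp (f x s) \<partial>service_law) \<le> exp B"
proof -
  have "(\<integral>s. exp (- B) \<partial>service_law) \<le> (\<integral>s. exp (f x s) \<partial>service_law)"
    using bounded by (intro integral_mono mark_section_integrable) (auto simp: abs_le_iff minus_le_iff)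
  then show "exp (- B) \<le> (\<integral>s. exp (f x s) \<partial>service_law)" using service.prob_space by simp
  have "(\<integral>s. exp (f x s) \<partial>service_law) \<le> (\<integral>s. exp B \<partial>service_law)"
    using bounded by (intro integral_mono mark_section_integrable) (auto simp: abs_le_iff)
  then show "(\<integral>s. exp (f x s) \<partial>service_law) \<le> exp B" using service.prob_space by simp
qed

lemma exp_mark_log_mean: "exp (mark_log_mean f x) = (\<integral>s. exp (f x s) \<partial>service_law)"
proof -
  have "0 < (\<integral>s. exp (f x s) \<partial>service_law)" using mark_mean_bounds(1)[of x] by (rule less_le_trans[rotated]) simp
  then show ?thesis by (simp add: mark_log_mean_def)
qed

lemma mark_log_mean_bounded: "\<bar>mark_log_mean f x\<bar> \<le> B"
proof -
  have "exp (- B) \<le> exp (mark_log_mean f x)" "exp (mark_log_mean f x) \<le> exp B"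
    unfolding exp_mark_log_mean by (rule mark_mean_bounds)+
  then show ?thesis by auto
qed

text \<open>
  Transfers integrability from \<open>f\<close> to its logarithmic mean \<open>l\<close>. Since \<open>\<bar>l\<bar> \<le> B\<close>, the number \<open>y = exp l\<close>
  stays away from 0, which bounds \<open>\<bar>l\<bar>\<close> by \<open>exp B * \<bar>y - 1\<bar>\<close>; and \<open>y - 1\<close> is the mean of \<open>exp f - 1\<close>,
  which is at most \<open>exp B * \<bar>f\<bar>\<close> in absolute value.
\<close>

lemma abs_mark_log_mean_le: "\<bar>mark_log_mean f x\<bar> \<le> exp (2 * B) * (\<integral>s. \<bar>f x s\<bar> \<partial>service_law)"
proof -
  let ?l = "mark_log_mean f x" and ?y = "\<integral>s. exp (f x s) \<partial>service_law"
  have y: "\<bar>?y - 1\<bar> \<le> exp B * (\<integral>s. \<bar>f x s\<bar> \<partial>service_law)"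
  proof -
    have "?y - 1 = (\<integral>s. exp (f x s) - 1 \<partial>service_law)"
      using mark_section_integrable(2) service.prob_space by simp
    also have "\<bar>\<dots>\<bar> \<le> (\<integral>s. \<bar>exp (f x s) - 1\<bar> \<partial>service_law)" by (rule integral_abs_bound)
    also have "\<dots> \<le> (\<integral>s. exp B * \<bar>f x s\<bar> \<partial>service_law)"
      by (intro integral_mono abs_exp_minus_one_le[OF bounded]) (auto simp: mark_section_integrable)
    finally show ?thesis by simp
  qed
  have "\<bar>?l\<bar> \<le> exp B * \<bar>exp ?l - 1\<bar>"
  proof (cases "0 \<le> ?l")
    case True
    have "?l \<le> exp ?l - 1" using exp_ge_add_one_self[of ?l] by linarith
    also have "\<dots> \<le> exp B * (exp ?l - 1)"
    proof -
      have "1 \<le> exp B" using bounded[of 0 0] by simp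
      then show ?thesis using True by (simp add: mult_le_cancel_right1)
    qed
    finally show ?thesis using True by simp
  next
    case False
    have "- ?l \<le> exp (- ?l) - 1" using exp_ge_add_one_self[of "- ?l"] by linarith
    also have "\<dots> = exp (- ?l) * (1 - exp ?l)" by (simp add: exp_minus algebra_simps)
    also have "\<dots> \<le> exp B * (1 - exp ?l)"
      using mark_log_mean_bounded[of x] False by (intro mult_right_mono) auto
    finally show ?thesis using False by simp
  qed
  also have "\<dots> \<le> exp B * (exp B * (\<integral>s. \<bar>f x s\<bar> \<partial>service_law))"
    using y by (intro mult_left_mono) (auto simp: exp_mark_log_mean)
  also have "\<dots> = exp (2 * B) * (\<integral>s. \<bar>f x s\<bar> \<partial>service_law)"
    by (simp add: exp_double power2_eq_square)
  finally show ?thesis .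
qed

lemma mark_log_mean_measurable: "mark_log_mean f \<in> borel_measurable borel"
proof -
  have "case_prod (\<lambda>x s. exp (f x s)) \<in> borel_measurable (borel \<Otimes>\<^sub>M borel)"
    using f unfolding case_prod_unfold by measurable
  then have "(\<lambda>x. \<integral>s. exp (f x s) \<partial>service_law) \<in> borel_measurable borel"
    by (intro service.borel_measurable_lebesgue_integral) (simp cong: measurable_cong_sets)
  then show ?thesis unfolding mark_log_mean_def[abs_def] by measurable
qed

lemma nn_integral_exp_mark_partial_sum:
  "(\<integral>\<^sup>+\<omega>. ennreal (exp (\<Sum>j<n. mark_sum_term f j \<omega>)) \<partial>M) =
   (\<integral>\<^sup>+\<omega>. ennreal (exp (\<Sum>j<n. at_epoch (mark_log_mean f) (epoch j \<omega>))) \<partial>M)"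
proof -
  let ?g = "\<lambda>y s. ennreal (exp (at_epoch (\<lambda>x. f x s) y))"
  let ?J = "int_decode ` {..<n}"
  have inj: "inj_on int_decode {..<n}" by (rule inj_int_decode)
  have gm: "case_prod ?g \<in> borel_measurable (borel \<Otimes>\<^sub>M borel)"
  proof -
    have [measurable]: "(\<lambda>z. f (real_of_ereal (fst z)) (snd z)) \<in> borel_measurable (borel \<Otimes>\<^sub>M borel)"
      by (rule measurable_curried[OF f]) measurable
    show ?thesis unfolding case_prod_unfold at_epoch_def by measurable
  qed
  have int: "(\<integral>\<^sup>+s. ?g y s \<partial>service_law) = ennreal (exp (at_epoch (mark_log_mean f) y))" for y
  proof (cases "\<bar>y\<bar> = \<infinity>")
    case True
    then show ?thesis using service.emeasure_space_1 by (simp add: at_epoch_def)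
  next
    case False
    then show ?thesis
      by (simp add: at_epoch_def nn_integral_eq_integral mark_section_integrable exp_mark_log_mean)
  qed
  have "(\<integral>\<^sup>+\<omega>. ennreal (exp (\<Sum>j<n. mark_sum_term f j \<omega>)) \<partial>M) =
      (\<integral>\<^sup>+\<omega>. (\<Prod>j\<in>?J. ?g (\<tau> j \<omega>) (\<sigma> j \<omega>)) \<partial>M)"
    by (simp add: mark_sum_term_def exp_sum prod_ennreal prod.reindex[OF inj])
  also have "\<dots> = (\<integral>\<^sup>+\<omega>. (\<Prod>j\<in>?J. \<integral>\<^sup>+s. ?g (\<tau> j \<omega>) s \<partial>service_law) \<partial>M)"
    by (rule nn_integral_prod_marks[OF gm]) simp
  also have "\<dots> = (\<integral>\<^sup>+\<omega>. ennreal (exp (\<Sum>j<n. at_epoch (mark_log_mean f) (epoch j \<omega>))) \<partial>M)"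
    by (simp only: int) (simp add: exp_sum prod_ennreal prod.reindex[OF inj])
  finally show ?thesis .
qed

end

text \<open>
  The exponential formula for the marked process. For every finite number of indices the marks can be
  averaged out, and both sides converge as that number grows. The majorant for the marked sum comes
  from the same averaging applied to \<open>\<bar>f\<bar>\<close>, whose logarithmic mean is nonnegative, bounded and
  integrable.
\<close>

theorem expectation_exp_mark_sum:
  assumes f: "case_prod f \<in> borel_measurable (borel \<Otimes>\<^sub>M borel)" and bounded: "\<And>x s. \<bar>f x s\<bar> \<le> B"
    and int: "integrable mean_measure (\<lambda>x. \<integral>s. \<bar>f x s\<bar> \<partial>service_law)"
  shows "AE \<omega> in M. summable (\<lambda>n. \<bar>mark_sum_term f n \<omega>\<bar>)"
    and "integrable M (\<lambda>\<omega>. exp (\<Sum>n. mark_sum_term f n \<omega>))"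
    and "expectation (\<lambda>\<omega>. exp (\<Sum>n. mark_sum_term f n \<omega>)) =
      exp (\<integral>x. (\<integral>s. exp (f x s) - 1 \<partial>service_law) \<partial>mean_measure)"
proof -
  define h where "h = (\<lambda>x s. \<bar>f x s\<bar>)"
  have h: "case_prod h \<in> borel_measurable (borel \<Otimes>\<^sub>M borel)"
    using f unfolding h_def case_prod_unfold by measurable
  have hb: "\<bar>h x s\<bar> \<le> B" for x s using bounded by (simp add: h_def)
  note [measurable] = mark_sum_term_measurable[OF f] mark_sum_term_measurable[OF h]
    mark_log_mean_measurable[OF f bounded] mark_log_mean_measurable[OF h hb]
  have log_int: "integrable mean_measure (mark_log_mean f)" "integrable mean_measure (mark_log_mean h)"
  proof -
    have i: "integrable mean_measure (\<lambda>x. exp (2 * B) * (\<integral>s. \<bar>f x s\<bar> \<partial>service_law))"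
      using int by simp
    have bd: "integrable mean_measure l"
      if l: "l \<in> borel_measurable borel" "\<And>x. \<bar>l x\<bar> \<le> exp (2 * B) * (\<integral>s. \<bar>f x s\<bar> \<partial>service_law)" for l
    proof (rule Bochner_Integration.integrable_bound[OF i])
      show "l \<in> borel_measurable mean_measure" using l(1) by measurable
      show "AE x in mean_measure. norm (l x) \<le> norm (exp (2 * B) * (\<integral>s. \<bar>f x s\<bar> \<partial>service_law))"
        unfolding real_norm_def by (intro AE_I2 order_trans[OF l(2) abs_ge_self])
    qed
    show "integrable mean_measure (mark_log_mean f)"
      by (rule bd[OF mark_log_mean_measurable[OF f bounded] abs_mark_log_mean_le[OF f bounded]])
    show "integrable mean_measure (mark_log_mean h)"
      using abs_mark_log_mean_le[OF h hb]
      by (intro bd[OF mark_log_mean_measurable[OF h hb]]) (simp add: h_def)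
  qed
  have h_nonneg: "0 \<le> mark_log_mean h x" for x
  proof -
    have "(\<integral>s. 1 \<partial>service_law) \<le> (\<integral>s. exp (h x s) \<partial>service_law)"
      by (intro integral_mono mark_section_integrable[OF h hb]) (auto simp: h_def)
    then have "1 \<le> exp (mark_log_mean h x)"
      using service.prob_space by (simp add: exp_mark_log_mean[OF h hb])
    then show ?thesis by simp
  qed
  obtain C where C: "(\<integral>\<^sup>+\<omega>. ennreal (exp (\<Sum>j<n. mark_sum_term h j \<omega>)) \<partial>M) \<le> ennreal C" for n
    using exp_sum_epochs_nonneg(3)[OF log_int(2) h_nonneg abs_le_D1[OF mark_log_mean_bounded[OF h hb]]]
    unfolding nn_integral_exp_mark_partial_sum[OF h hb] by blast
  have mh: "mark_sum_term h n \<omega> = \<bar>mark_sum_term f n \<omega>\<bar>" for n \<omega>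
    by (simp add: mark_sum_term_def h_def at_epoch_abs)
  have dom: "AE \<omega> in M. summable (\<lambda>n. \<bar>mark_sum_term f n \<omega>\<bar>)"
      "integrable M (\<lambda>\<omega>. exp (\<Sum>n. \<bar>mark_sum_term f n \<omega>\<bar>))"
    using exp_partial_sums_bounded[OF _ _ C] unfolding mh by auto
  show "AE \<omega> in M. summable (\<lambda>n. \<bar>mark_sum_term f n \<omega>\<bar>)" by (rule dom)
  show "integrable M (\<lambda>\<omega>. exp (\<Sum>n. mark_sum_term f n \<omega>))"
    by (rule integral_exp_partial_sums_tendsto(1)[OF _ dom]) measurable
  have lim_marks: "(\<lambda>n. \<integral>\<omega>. exp (\<Sum>j<n. mark_sum_term f j \<omega>) \<partial>M) \<longlonglongrightarrow>
      expectation (\<lambda>\<omega>. exp (\<Sum>n. mark_sum_term f n \<omega>))"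
    by (rule integral_exp_partial_sums_tendsto(2)[OF _ dom]) measurable
  let ?e = "\<lambda>n \<omega>. at_epoch (mark_log_mean f) (epoch n \<omega>)"
  have log_dom: "AE \<omega> in M. summable (\<lambda>n. \<bar>?e n \<omega>\<bar>)"
      "integrable M (\<lambda>\<omega>. exp (\<Sum>n. \<bar>?e n \<omega>\<bar>))"
    using exp_sum_epochs_nonneg(1,2)[OF integrable_abs[OF log_int(1)] abs_ge_zero mark_log_mean_bounded[OF f bounded]]
    by (simp_all add: at_epoch_abs)
  have lim_logs: "(\<lambda>n. \<integral>\<omega>. exp (\<Sum>j<n. ?e j \<omega>) \<partial>M) \<longlonglongrightarrow> expectation (\<lambda>\<omega>. exp (\<Sum>n. ?e n \<omega>))"
    by (rule integral_exp_partial_sums_tendsto(2)[OF _ log_dom]) measurable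
  have "(\<integral>\<omega>. exp (\<Sum>j<n. mark_sum_term f j \<omega>) \<partial>M) = (\<integral>\<omega>. exp (\<Sum>j<n. ?e j \<omega>) \<partial>M)" for n
    by (simp add: integral_eq_nn_integral nn_integral_exp_mark_partial_sum[OF f bounded])
  with lim_marks lim_logs
  have "expectation (\<lambda>\<omega>. exp (\<Sum>n. mark_sum_term f n \<omega>)) = expectation (\<lambda>\<omega>. exp (\<Sum>n. ?e n \<omega>))"
    using LIMSEQ_unique by auto
  also have "\<dots> = exp (\<integral>x. (exp (mark_log_mean f x) - 1) \<partial>mean_measure)"
    by (rule expectation_exp_sum_epochs[OF log_int(1) mark_log_mean_bounded[OF f bounded]])
  also have "(\<lambda>x. exp (mark_log_mean f x) - 1) = (\<lambda>x. \<integral>s. exp (f x s) - 1 \<partial>service_law)"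
    using mark_section_integrable(2)[OF f bounded] service.prob_space
    by (simp add: exp_mark_log_mean[OF f bounded])
  finally show "expectation (\<lambda>\<omega>. exp (\<Sum>n. mark_sum_term f n \<omega>)) =
      exp (\<integral>x. (\<integral>s. exp (f x s) - 1 \<partial>service_law) \<partial>mean_measure)" .
qed

end

section \<open>Queue lengths at finitely many times\<close>

text \<open>
  Indicator that a customer arriving at \<open>x\<close> with service time \<open>s\<close> is in the system at time \<open>t\<close>.
\<close>

definition busy :: "real \<Rightarrow> real \<Rightarrow> real \<Rightarrow> real" where
  "busy t x s = of_bool (x \<le> t \<and> t - x < s)"

lemma busy_measurable: "case_prod (busy t) \<in> borel_measurable (borel \<Otimes>\<^sub>M borel)"
  unfolding busy_def case_prod_unfold by measurable

lemma queue_length_term: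
  "of_bool (y \<le> ereal t \<and> ereal s > ereal t - y) = at_epoch (\<lambda>x. busy t x s) y"
  by (cases y) (auto simp: at_epoch_def busy_def)

text \<open>
  Let \<open>t j < x \<le> t (j+1)\<close>. Then the indicators \<open>x \<le> t i\<close> with \<open>1 \<le> i \<le> k\<close> are 1 exactly for
  \<open>i \<ge> j + 1\<close>, so the exponent is \<open>\<theta> (j+1) + \<dots> + \<theta> k\<close>. If \<open>x > t k\<close>, both sides vanish. The
  convention \<open>t 0 = -\<infinity>\<close> makes these cases exhaustive.
\<close>

lemma exp_sum_crossing:
  fixes t \<theta> :: "nat \<Rightarrow> real"
  assumes t: "strict_mono_on {1..k} t"
  shows "exp (\<Sum>i=1..k. \<theta> i * of_bool (x \<le> t i)) - 1 =
    (\<Sum>j<k. (exp (\<Sum>i=j+1..k. \<theta> i) - 1) * of_bool (ext_time t j < ereal x \<and> x \<le> t (j+1)))"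
proof (cases "k \<ge> 1 \<and> x \<le> t k")
  case True
  \<comment> \<open>The point \<open>x\<close> lies in the interval number \<open>l - 1\<close>, counted from 0.\<close>
  define l where "l = (LEAST i. 1 \<le> i \<and> x \<le> t i)"
  have l: "1 \<le> l" "x \<le> t l" "l \<le> k"
    using LeastI[of "\<lambda>i. 1 \<le> i \<and> x \<le> t i" k] Least_le[of "\<lambda>i. 1 \<le> i \<and> x \<le> t i" k] True
    by (auto simp: l_def)
  have below: "t i < x" if "1 \<le> i" "i < l" for i
    using not_less_Least[of i "\<lambda>i. 1 \<le> i \<and> x \<le> t i"] that by (auto simp: l_def)
  have above: "x \<le> t i" if "l \<le> i" "i \<le> k" for i
  proof -
    have "t l \<le> t i" using that l by (intro strict_mono_on_leD[OF t]) auto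
    with l(2) show ?thesis by simp
  qed
  have only: "(ext_time t j < ereal x \<and> x \<le> t (j+1)) \<longleftrightarrow> j = l - 1" if "j < k" for j
  proof
    assume A: "ext_time t j < ereal x \<and> x \<le> t (j+1)"
    have "\<not> l \<le> j" using A above[of j] that l(1) by (auto simp: ext_time_def split: if_splits)
    moreover have "\<not> j + 1 < l" using A below[of "j+1"] by auto
    ultimately show "j = l - 1" by linarith
  next
    assume "j = l - 1"
    then show "ext_time t j < ereal x \<and> x \<le> t (j+1)"
      using l below[of j] by (auto simp: ext_time_def)
  qed
  have "(\<Sum>i=1..k. \<theta> i * of_bool (x \<le> t i)) = (\<Sum>i=l..k. \<theta> i * of_bool (x \<le> t i))"
    using l below by (intro sum.mono_neutral_right) (auto simp: not_le[symmetric])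
  also have "\<dots> = (\<Sum>i=l..k. \<theta> i)" using above by (intro sum.cong) auto
  finally have L: "(\<Sum>i=1..k. \<theta> i * of_bool (x \<le> t i)) = (\<Sum>i=l..k. \<theta> i)" .
  have "(\<Sum>j<k. (exp (\<Sum>i=j+1..k. \<theta> i) - 1) * of_bool (ext_time t j < ereal x \<and> x \<le> t (j+1))) =
      (\<Sum>j<k. if j = l - 1 then exp (\<Sum>i=j+1..k. \<theta> i) - 1 else 0)"
    by (intro sum.cong refl) (use only in auto)
  also have "\<dots> = exp (\<Sum>i=l..k. \<theta> i) - 1" using l by simp
  finally show ?thesis using L by simp
next
  case False
  have gt: "\<not> x \<le> t i" if "1 \<le> i" "i \<le> k" for i
  proof -
    have "t i \<le> t k" using that by (intro strict_mono_on_leD[OF t]) auto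
    with False that show ?thesis by auto
  qed
  have "(\<Sum>i=1..k. \<theta> i * of_bool (x \<le> t i)) = 0" using gt by (intro sum.neutral) auto
  moreover have "(\<Sum>j<k. (exp (\<Sum>i=j+1..k. \<theta> i) - 1) * of_bool (ext_time t j < ereal x \<and> x \<le> t (j+1))) = 0"
    using gt by (intro sum.neutral) auto
  ultimately show ?thesis by simp
qed

text \<open>
  The algebraic source of the double sum, obtained by telescoping over the observation times. Adding
  the time \<open>t (k+1)\<close> changes the exponential only if the customer is present then. Such a customer
  has not left before, so presence at an earlier time \<open>t i\<close> just means arrival by time \<open>t i\<close>, and the
  exponential accumulated so far depends only on the interval that contains the arrival epoch.
\<close>

lemma exp_sum_busy:
  fixes t \<theta> :: "nat \<Rightarrow> real"
  assumes "strict_mono_on {1..m} t"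
  shows "exp (\<Sum>i=1..m. \<theta> i * busy (t i) x s) - 1 =
    (\<Sum>k=1..m. (exp (\<theta> k) - 1) * busy (t k) x s) +
    (\<Sum>k=1..m-1. (exp (\<theta> (k+1)) - 1) * (\<Sum>j=0..k-1. (exp (\<Sum>i=j+1..k. \<theta> i) - 1) *
       (busy (t (k+1)) x s * of_bool (ext_time t j < ereal x \<and> x \<le> t (j+1)))))"
  using assms
proof (induction m)
  case 0
  then show ?case by simp
next
  case (Suc m)
  let ?b = "busy (t (Suc m)) x s"
  let ?c = "\<lambda>k. (exp (\<theta> (k+1)) - 1) * (\<Sum>j=0..k-1. (exp (\<Sum>i=j+1..k. \<theta> i) - 1) *
       (busy (t (k+1)) x s * of_bool (ext_time t j < ereal x \<and> x \<le> t (j+1))))"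
  have mono: "strict_mono_on {1..m} t"
    by (rule monotone_on_subset[OF Suc.prems]) auto
  have step: "?b * (exp (\<Sum>i=1..m. \<theta> i * busy (t i) x s) - 1) =
      (\<Sum>j<m. (exp (\<Sum>i=j+1..m. \<theta> i) - 1) * (?b * of_bool (ext_time t j < ereal x \<and> x \<le> t (j+1))))"
  proof (cases "?b = 0")
    case False
    then have b: "?b = 1" "t (Suc m) - x < s" by (auto simp: busy_def split: if_splits)
    have "busy (t i) x s = of_bool (x \<le> t i)" if "i \<in> {1..m}" for i
    proof -
      have "t i < t (Suc m)" using that by (intro strict_mono_onD[OF Suc.prems]) auto
      with b(2) show ?thesis by (simp add: busy_def)
    qed
    then show ?thesis
      using exp_sum_crossing[OF mono, of \<theta> x] b(1) by simp
  qed simp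
  have top: "(\<Sum>k=1..Suc m - 1. ?c k) = (\<Sum>k=1..m-1. ?c k) +
      (exp (\<theta> (Suc m)) - 1) * (?b * (exp (\<Sum>i=1..m. \<theta> i * busy (t i) x s) - 1))"
  proof (cases m)
    case 0
    then show ?thesis by simp
  next
    case (Suc n)
    have "{0..m - 1} = {..<m}" using Suc by auto
    then have "?c m = (exp (\<theta> (Suc m)) - 1) * (?b * (exp (\<Sum>i=1..m. \<theta> i * busy (t i) x s) - 1))"
      using step by simp
    then show ?thesis using Suc by simp
  qed
  have e: "exp (\<theta> (Suc m) * ?b) = 1 + (exp (\<theta> (Suc m)) - 1) * ?b"
    by (simp add: busy_def)
  have "exp (\<Sum>i=1..Suc m. \<theta> i * busy (t i) x s) - 1 =
      (exp (\<Sum>i=1..m. \<theta> i * busy (t i) x s) - 1) + (exp (\<theta> (Suc m)) - 1) * ?b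
      + (exp (\<theta> (Suc m)) - 1) * (?b * (exp (\<Sum>i=1..m. \<theta> i * busy (t i) x s) - 1))"
    by (simp add: exp_add e algebra_simps)
  then show ?case unfolding Suc.IH[OF mono] top by simp
qed

context Mt_G_infinity_queue
begin

lemma G_eq: "G u = service.prob {..u}"
  by (simp only: service_cdf[of 0, symmetric] cdf_def)

lemma one_minus_G: "1 - G u = service.prob {u<..}"
proof -
  have "{u<..} = space service_law - {..u}" by auto
  then show ?thesis using service.prob_compl[of "{..u}"] by (simp add: G_eq)
qed

lemma G_measurable [measurable]: "G \<in> borel_measurable borel"
  by (rule borel_measurable_mono)
     (auto simp: mono_def G_eq intro!: service.finite_measure_mono)

lemma integral_busy: "(\<integral>s. busy t x s \<partial>service_law) = of_bool (x \<le> t) * (1 - G (t - x))"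
proof -
  have "(\<integral>s. busy t x s \<partial>service_law) = (\<integral>s. of_bool (x \<le> t) * indicator {t - x<..} s \<partial>service_law)"
    by (intro Bochner_Integration.integral_cong) (auto simp: busy_def)
  then show ?thesis by (simp add: one_minus_G)
qed

text \<open>
  The substitution \<open>u = t - x\<close> turns age into arrival epoch: a customer arriving in \<open>(p, q]\<close> has age in
  \<open>[t - q, t - p)\<close> at time \<open>t\<close>. The half-open interval and the open interval of integration differ in
  one point only.
\<close>

lemma has_integral_H_between:
  assumes fin: "H_finite G lam t" and pq: "p \<le> ereal q" "q \<le> t"
  shows "has_bochner_integral mean_measure
    (\<lambda>x. (\<integral>s. busy t x s \<partial>service_law) * of_bool (p < ereal x \<and> x \<le> q))
    (H_between G lam (ereal t - ereal q) (ereal t - p) t)"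
proof -
  note [measurable] = intensity_measurable
  let ?a = "ereal t - ereal q" and ?b = "ereal t - p"
  let ?g = "\<lambda>u. (1 - G u) * lam (t - u)"
  have ab: "?a \<le> ?b" using pq by (intro ereal_minus_mono) auto
  have a0: "0 \<le> ?a" using pq by simp
  have "set_integrable lborel (einterval 0 \<infinity>) ?g"
    using fin by (simp add: H_finite_def interval_lebesgue_integrable_def)
  then have "set_integrable lborel (einterval ?a ?b) ?g"
    by (rule set_integrable_subset) (use a0 in \<open>auto simp: einterval_def intro: le_less_trans\<close>)
  moreover have "(LINT u:einterval ?a ?b|lborel. ?g u) = H_between G lam ?a ?b t"
    using ab by (simp add: H_between_def interval_lebesgue_integral_def)
  ultimately have "has_bochner_integral lborel (\<lambda>u. indicator (einterval ?a ?b) u * ?g u) (H_between G lam ?a ?b t)"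
    by (simp add: has_bochner_integral_iff set_integrable_def set_lebesgue_integral_def)
  then have "has_bochner_integral lborel
      (\<lambda>x. indicator (einterval ?a ?b) (t + (- 1) * x) * ?g (t + (- 1) * x)) (H_between G lam ?a ?b t)"
    by (subst (asm) lborel_has_bochner_integral_real_affine_iff[where c="-1" and t=t]) simp_all
  moreover have "AE x in lborel. lam x *\<^sub>R ((\<integral>s. busy t x s \<partial>service_law) * of_bool (p < ereal x \<and> x \<le> q)) =
      indicator (einterval ?a ?b) (t + (- 1) * x) * ?g (t + (- 1) * x)"
    using AE_lborel_singleton[of q]
  proof eventually_elim
    case (elim x)
    have "t + (- 1) * x \<in> einterval ?a ?b \<longleftrightarrow> p < ereal x \<and> x \<le> q"
      using elim pq by (cases p) (auto simp: einterval_def)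
    then show ?case using pq by (auto simp: integral_busy split: split_indicator)
  qed
  ultimately have "has_bochner_integral lborel
      (\<lambda>x. lam x *\<^sub>R ((\<integral>s. busy t x s \<partial>service_law) * of_bool (p < ereal x \<and> x \<le> q)))
      (H_between G lam ?a ?b t)"
    by (subst has_bochner_integral_cong_AE) (auto simp: integral_busy)
  then show ?thesis unfolding intensity_measure_def
    by (intro has_bochner_integral_density) (auto simp: integral_busy intensity_nonneg)
qed

lemma has_integral_H_total:
  assumes fin: "H_finite G lam t"
  shows "has_bochner_integral mean_measure (\<lambda>x. \<integral>s. busy t x s \<partial>service_law) (H_total G lam t)"
proof -
  have "(\<integral>s. busy t x s \<partial>service_law) * of_bool (- \<infinity> < ereal x \<and> x \<le> t) = (\<integral>s. busy t x s \<partial>service_law)" for x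
    by (simp add: integral_busy)
  moreover have "H_between G lam (ereal t - ereal t) (ereal t - - \<infinity>) t = H_total G lam t"
    by (simp add: H_between_def H_total_def flip: zero_ereal_def)
  ultimately show ?thesis
    using has_integral_H_between[OF fin, of "- \<infinity>" t] by (simp only: ereal_less_eq order_refl)
qed

lemma integrable_busy: "integrable service_law (busy t x)"
  by (rule mark_section_integrable(1)[OF busy_measurable, of _ 1]) (simp add: busy_def)

lemma busy_summable_AE:
  assumes fin: "H_finite G lam t"
  shows "AE \<omega> in M. summable (\<lambda>n. mark_sum_term (busy t) n \<omega>)"
proof -
  have a: "\<bar>busy t x s\<bar> = busy t x s" for x s by (simp add: busy_def)
  have b: "\<bar>mark_sum_term (busy t) n \<omega>\<bar> = mark_sum_term (busy t) n \<omega>" for n \<omega>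
    by (simp add: mark_sum_term_def at_epoch_def busy_def)
  have "AE \<omega> in M. summable (\<lambda>n. \<bar>mark_sum_term (busy t) n \<omega>\<bar>)"
    by (rule expectation_exp_mark_sum(1)[OF busy_measurable, of _ 1])
       (use has_integral_H_total[OF fin] in \<open>auto simp: a has_bochner_integral_iff\<close>, simp add: busy_def)
  then show ?thesis by (simp add: b)
qed

text \<open>
  The queue length is measurable because it is the real value of a series in \<^typ>\<open>ennreal\<close>: both the
  unordered sum over the integers and \<^const>\<open>enn2real\<close> take the value 0 on divergence. Where the series
  converges, it is an ordinary sum over the marked points.
\<close>

lemma queue_length_eq:
  "queue_length \<tau> \<sigma> t \<omega> = enn2real (\<Sum>n. ennreal (mark_sum_term (busy t) n \<omega>))"
  "summable (\<lambda>n. mark_sum_term (busy t) n \<omega>) \<Longrightarrow>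
    queue_length \<tau> \<sigma> t \<omega> = (\<Sum>n. mark_sum_term (busy t) n \<omega>)"
proof -
  let ?a = "\<lambda>n. mark_sum_term (busy t) n \<omega>"
  have nonneg: "0 \<le> ?a n" for n by (simp add: mark_sum_term_def at_epoch_def busy_def)
  have "queue_length \<tau> \<sigma> t \<omega> = (\<Sum>\<^sub>\<infinity>j. at_epoch (\<lambda>x. busy t x (\<sigma> j \<omega>)) (\<tau> j \<omega>))"
    by (simp only: queue_length_def queue_length_term)
  also have "\<dots> = (\<Sum>\<^sub>\<infinity>n. ?a n)"
    unfolding mark_sum_term_def by (rule infsum_reindex_bij_betw[OF bij_int_decode, symmetric])
  finally have q: "queue_length \<tau> \<sigma> t \<omega> = (\<Sum>\<^sub>\<infinity>n. ?a n)" .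
  show s: "queue_length \<tau> \<sigma> t \<omega> = (\<Sum>n. ?a n)" if "summable ?a"
    unfolding q using that nonneg
    by (intro infsumI norm_summable_imp_has_sum summable_sums) auto
  show "queue_length \<tau> \<sigma> t \<omega> = enn2real (\<Sum>n. ennreal (?a n))"
  proof (cases "summable ?a")
    case True
    then show ?thesis by (simp add: s suminf_ennreal2 nonneg suminf_nonneg)
  next
    case False
    then have "\<not> ?a summable_on UNIV" using summable_on_imp_summable by blast
    then have "queue_length \<tau> \<sigma> t \<omega> = 0" unfolding q by (rule infsum_not_exists)
    moreover have "(\<Sum>n. ennreal (?a n)) = top"
      using False summable_suminf_not_top[of ?a] nonneg by blast
    ultimately show ?thesis by simp
  qed
qed

lemma queue_length_measurable [measurable]: "queue_length \<tau> \<sigma> t \<in> borel_measurable M"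
proof -
  note [measurable] = mark_sum_term_measurable[OF busy_measurable]
  show ?thesis unfolding queue_length_eq(1)[abs_def] by measurable
qed

text \<open>
  The linear combination of queue lengths is almost surely the sum of
  \<open>f x s = (\<Sum>i=1..m. \<theta> i * busy (t i) x s)\<close> over the marked points, so the exponential formula applies.
  Its exponent is evaluated by integrating the telescoped form of \<open>exp (f x s) - 1\<close> term by term.
\<close>

theorem mgf_queue_length:
  fixes t \<theta> :: "nat \<Rightarrow> real"
  assumes fin: "\<And>s. H_finite G lam s" and t: "strict_mono_on {1..m} t"
  shows "integrable M (\<lambda>\<omega>. exp (\<Sum>i=1..m. \<theta> i * queue_length \<tau> \<sigma> (t i) \<omega>))"
    and "expectation (\<lambda>\<omega>. exp (\<Sum>i=1..m. \<theta> i * queue_length \<tau> \<sigma> (t i) \<omega>)) =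
      exp ((\<Sum>k=1..m. (exp (\<theta> k) - 1) * H_total G lam (t k)) +
        (\<Sum>k=1..m-1. (exp (\<theta> (k+1)) - 1) *
          (\<Sum>j=0..k-1. (exp (\<Sum>i=j+1..k. \<theta> i) - 1) *
            H_between G lam (ext_time t (k+1) - ext_time t (j+1))
              (ext_time t (k+1) - ext_time t j) (t (k+1)))))"
proof -
  define f where "f = (\<lambda>x s. \<Sum>i=1..m. \<theta> i * busy (t i) x s)"
  define B where "B = (\<Sum>i=1..m. \<bar>\<theta> i\<bar>)"
  let ?S = "\<lambda>\<omega>. exp (\<Sum>n. mark_sum_term f n \<omega>)"
  let ?X = "\<lambda>\<omega>. exp (\<Sum>i=1..m. \<theta> i * queue_length \<tau> \<sigma> (t i) \<omega>)"
  have f: "case_prod f \<in> borel_measurable (borel \<Otimes>\<^sub>M borel)"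
    using busy_measurable unfolding f_def case_prod_unfold by measurable
  have fle: "\<bar>f x s\<bar> \<le> (\<Sum>i=1..m. \<bar>\<theta> i\<bar> * busy (t i) x s)" for x s
    unfolding f_def by (rule order_trans[OF sum_abs], rule sum_mono) (simp add: busy_def)
  have fB: "\<bar>f x s\<bar> \<le> B" for x s
    unfolding B_def by (rule order_trans[OF fle], rule sum_mono) (simp add: busy_def)
  have fi: "integrable mean_measure (\<lambda>x. \<integral>s. \<bar>f x s\<bar> \<partial>service_law)"
  proof (rule Bochner_Integration.integrable_bound)
    show "integrable mean_measure (\<lambda>x. \<Sum>i=1..m. \<bar>\<theta> i\<bar> * (\<integral>s. busy (t i) x s \<partial>service_law))"
      using has_integral_H_total[OF fin]
      by (intro Bochner_Integration.integrable_sum integrable_mult_right) (auto simp: has_bochner_integral_iff)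
    have "case_prod (\<lambda>x s. \<bar>f x s\<bar>) \<in> borel_measurable (borel \<Otimes>\<^sub>M borel)"
      using f unfolding case_prod_unfold by measurable
    then have "(\<lambda>x. \<integral>s. \<bar>f x s\<bar> \<partial>service_law) \<in> borel_measurable borel"
      by (intro service.borel_measurable_lebesgue_integral) (simp cong: measurable_cong_sets)
    then show "(\<lambda>x. \<integral>s. \<bar>f x s\<bar> \<partial>service_law) \<in> borel_measurable mean_measure"
      by measurable
    have "(\<integral>s. \<bar>f x s\<bar> \<partial>service_law) \<le> (\<Sum>i=1..m. \<bar>\<theta> i\<bar> * (\<integral>s. busy (t i) x s \<partial>service_law))" for x
    proof -
      have "(\<integral>s. \<bar>f x s\<bar> \<partial>service_law) \<le> (\<integral>s. (\<Sum>i=1..m. \<bar>\<theta> i\<bar> * busy (t i) x s) \<partial>service_law)"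
        by (intro integral_mono fle integrable_abs mark_section_integrable[OF f fB]
            Bochner_Integration.integrable_sum integrable_mult_right integrable_busy)
      also have "\<dots> = (\<Sum>i=1..m. \<bar>\<theta> i\<bar> * (\<integral>s. busy (t i) x s \<partial>service_law))"
        by (simp add: Bochner_Integration.integral_sum integrable_busy)
      finally show ?thesis .
    qed
    moreover have "0 \<le> (\<integral>s. \<bar>f x s\<bar> \<partial>service_law)" for x
      by (intro Bochner_Integration.integral_nonneg) auto
    ultimately show "AE x in mean_measure. norm (\<integral>s. \<bar>f x s\<bar> \<partial>service_law) \<le>
        norm (\<Sum>i=1..m. \<bar>\<theta> i\<bar> * (\<integral>s. busy (t i) x s \<partial>service_law))"
      by (intro AE_I2) (simp add: abs_of_nonneg order_trans[OF _ abs_ge_self])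
  qed
  note main = expectation_exp_mark_sum[OF f fB fi]
  have "AE \<omega> in M. \<forall>i\<in>{1..m}. summable (\<lambda>n. mark_sum_term (busy (t i)) n \<omega>)"
    by (intro AE_finite_allI busy_summable_AE fin) simp
  then have eq: "AE \<omega> in M. ?X \<omega> = ?S \<omega>"
  proof eventually_elim
    case (elim \<omega>)
    have "(\<Sum>i=1..m. \<theta> i * queue_length \<tau> \<sigma> (t i) \<omega>) =
        (\<Sum>i=1..m. \<Sum>n. \<theta> i * mark_sum_term (busy (t i)) n \<omega>)"
      using elim by (intro sum.cong refl) (simp add: queue_length_eq(2) suminf_mult)
    also have "\<dots> = (\<Sum>n. \<Sum>i=1..m. \<theta> i * mark_sum_term (busy (t i)) n \<omega>)"
      using elim by (intro suminf_sum[symmetric] summable_mult) auto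
    also have "\<dots> = (\<Sum>n. mark_sum_term f n \<omega>)"
      by (rule suminf_cong) (simp add: mark_sum_term_def f_def at_epoch_def)
    finally show ?case by simp
  qed
  have [measurable]: "?S \<in> borel_measurable M" using main(2) by auto
  have [measurable]: "?X \<in> borel_measurable M" by measurable
  show "integrable M ?X"
    using main(2) eq by (subst integrable_cong_AE) auto
  have "expectation ?X = expectation ?S"
    using eq by (intro integral_cong_AE) auto
  also have "\<dots> = exp (\<integral>x. (\<integral>s. exp (f x s) - 1 \<partial>service_law) \<partial>mean_measure)"
    by (rule main(3))
  also have "(\<integral>x. (\<integral>s. exp (f x s) - 1 \<partial>service_law) \<partial>mean_measure) =
      (\<Sum>k=1..m. (exp (\<theta> k) - 1) * H_total G lam (t k)) +
        (\<Sum>k=1..m-1. (exp (\<theta> (k+1)) - 1) *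
          (\<Sum>j=0..k-1. (exp (\<Sum>i=j+1..k. \<theta> i) - 1) *
            H_between G lam (ext_time t (k+1) - ext_time t (j+1))
              (ext_time t (k+1) - ext_time t j) (t (k+1))))"
    (is "_ = ?R")
  proof -
    let ?b = "\<lambda>k x. \<integral>s. busy (t k) x s \<partial>service_law"
    let ?I = "\<lambda>j x. of_bool (ext_time t j < ereal x \<and> x \<le> t (j+1)) :: real"
    have inner: "(\<integral>s. exp (f x s) - 1 \<partial>service_law) =
        (\<Sum>k=1..m. (exp (\<theta> k) - 1) * ?b k x) +
        (\<Sum>k=1..m-1. (exp (\<theta> (k+1)) - 1) * (\<Sum>j=0..k-1. (exp (\<Sum>i=j+1..k. \<theta> i) - 1) *
          (?b (k+1) x * ?I j x)))" for x
    proof (rule has_bochner_integral_integral_eq)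
      have b: "has_bochner_integral service_law (busy (t k) x) (?b k x)" for k
        by (rule has_bochner_integral_integrable[OF integrable_busy])
      show "has_bochner_integral service_law (\<lambda>s. exp (f x s) - 1)
        ((\<Sum>k=1..m. (exp (\<theta> k) - 1) * ?b k x) +
        (\<Sum>k=1..m-1. (exp (\<theta> (k+1)) - 1) * (\<Sum>j=0..k-1. (exp (\<Sum>i=j+1..k. \<theta> i) - 1) *
          (?b (k+1) x * ?I j x))))"
        unfolding f_def exp_sum_busy[OF t]
        by (intro has_bochner_integral_add has_bochner_integral_sum has_bochner_integral_mult_right
            has_bochner_integral_mult_left b)
    qed
    have between: "has_bochner_integral mean_measure (\<lambda>x. ?b (k+1) x * ?I j x)
        (H_between G lam (ext_time t (k+1) - ext_time t (j+1)) (ext_time t (k+1) - ext_time t j) (t (k+1)))"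
      if "k \<in> {1..m-1}" "j \<in> {0..k-1}" for k j
    proof -
      have "ext_time t j \<le> ereal (t (j+1))"
        using that by (auto simp: ext_time_def intro!: strict_mono_on_leD[OF t])
      moreover have "t (j+1) \<le> t (k+1)"
        using that by (intro strict_mono_on_leD[OF t]) auto
      ultimately have "has_bochner_integral mean_measure (\<lambda>x. ?b (k+1) x * ?I j x)
          (H_between G lam (ereal (t (k+1)) - ereal (t (j+1))) (ereal (t (k+1)) - ext_time t j) (t (k+1)))"
        by (rule has_integral_H_between[OF fin])
      then show ?thesis by (simp add: ext_time_def)
    qed
    have "has_bochner_integral mean_measure (\<lambda>x. \<integral>s. exp (f x s) - 1 \<partial>service_law) ?R"
      unfolding inner
      by (intro has_bochner_integral_add has_bochner_integral_sum has_bochner_integral_mult_right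
          has_integral_H_total[OF fin] between)
    then show ?thesis by (rule has_bochner_integral_integral_eq)
  qed
  finally show "expectation ?X = exp ?R" .
qed

end

theorem theorem1:
  fixes M :: "'a measure" and lam G :: "real \<Rightarrow> real"
    and \<tau> :: "int \<Rightarrow> 'a \<Rightarrow> ereal" and \<sigma> :: "int \<Rightarrow> 'a \<Rightarrow> real"
    and m :: nat and t \<theta> :: "nat \<Rightarrow> real"
  assumes "Mt_G_infinity_queue M lam \<tau> \<sigma> G"
    and "\<And>s. H_finite G lam s"
    and "m \<ge> 1"
    and "strict_mono_on {1..m} t"
  shows "integrable M (\<lambda>\<omega>. exp (\<Sum>i=1..m. \<theta> i * queue_length \<tau> \<sigma> (t i) \<omega>)) \<and>
    ln (prob_space.expectation M (\<lambda>\<omega>. exp (\<Sum>i=1..m. \<theta> i * queue_length \<tau> \<sigma> (t i) \<omega>))) =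
      (\<Sum>k=1..m. (exp (\<theta> k) - 1) * H_total G lam (t k)) +
      (\<Sum>k=1..m-1. (exp (\<theta> (k+1)) - 1) *
        (\<Sum>j=0..k-1. (exp (\<Sum>i=j+1..k. \<theta> i) - 1) *
          H_between G lam (ext_time t (k+1) - ext_time t (j+1))
            (ext_time t (k+1) - ext_time t j) (t (k+1))))"
proof -
  interpret Mt_G_infinity_queue M lam \<tau> \<sigma> G by (rule assms(1))
  show ?thesis
    using mgf_queue_length[OF assms(2,4), of \<theta>] by simp
qed

end
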